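(* Let $\mathcal{M}$ be a simple matroid, and suppose there are $3$-nets $\mathcal{N}$, $\mathcal{N}'$, and $\mathcal{N}''$ on $\mathcal{M}$ such that the classes $[\lambda_{\mathbb{F}_3}(\mathcal{N})]$, $[\lambda_{\mathbb{F}_3}(\mathcal{N}')]$, and $[\lambda_{\mathbb{F}_3}(\mathcal{N}'')]$ are linearly independent in $Z_{\mathbb{F}_3}(\mathcal{M})/B_{\mathbb{F}_3}(\mathcal{M})$. Then $\mathcal{M}$ is not realizable over $\mathbb{C}$.
   Context: A matroid is simple if all subsets of size at most two are independent; $L(\mathcal{M})$ is its lattice of flats, $L_2(\mathcal{M})$ the set of rank-$2$ flats, and $u\vee v$ the flat spanned by $u,v$. A simple matroid $\mathcal{M}$ is realizable over $\mathbb{C}$ if there is a central arrangement $\mathcal{A}$ of hyperplanes in some $\mathbb{C}^\ell$ with $L(\mathcal{M})\cong L(\mathcal{A})$, where $L(\mathcal{A})$ is the intersection lattice (intersections of hyperplanes ordered by reverse inclusion, ranked by codimension). A $k$-multinet on $\mathcal{M}$ ($k\ge 3$) is a partition of $\mathcal{M}$ into $k$ non-empty (labelled) classes $\mathcal{M}_\alpha$, with positive integer multiplicities $m\colon\mathcal{M}\to\mathbb{N}$ and a base locus $\mathcal{X}\subseteq L_2(\mathcal{M})$ with $|X|>2$ for all $X\in\mathcal{X}$, such that: (1) $\sum_{u\in\mathcal{M}_\alpha}m_u$ is independent of $\alpha$; (2) if $u,v$ are in different classes, then $u\vee v\in\mathcal{X}$; (3) for $X\in\mathcal{X}$, $n_X:=\sum_{u\in\mathcal{M}_\alpha\cap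 X}m_u$ is independent of $\alpha$; (4) for $u,v\in\mathcal{M}_\alpha$ there is a sequence $u=u_0,\dots,u_r=v$ with $u_{i-1}\vee u_i\notin\mathcal{X}$ for all $i$. A $k$-net is a $k$-multinet with $n_X=1$ for all $X\in\mathcal{X}$. For a $3$-net $\mathcal{N}$ with partition $\mathcal{M}=\coprod_{\alpha\in\mathbb{F}_3}\mathcal{M}_\alpha$, $\lambda_{\mathbb{F}_3}(\mathcal{N})\in\mathbb{F}_3^{\mathcal{M}}$ is the function equal to $\alpha$ on $\mathcal{M}_\alpha$. The Orlik–Solomon algebra is $A(\mathcal{M})=E/(\partial e_S : S\text{ a circuit})$, with $E$ the exterior algebra over $\mathbb{Z}$ on degree-one generators $e_u$, $u\in\mathcal{M}$, $\partial$ the graded derivation of degree $-1$ with $\partial e_u=1$, $e_S=\prod_{u\in S}e_u$. With $\sigma=\sum_u e_u$, put $Z_{\mathbb{F}_3}(\mathcal{M})=\{\tau\in\mathbb{F}_3^{\mathcal{M}}=A^1(\mathcal{M})\otimes\mathbb{F}_3\mid\sigma\tau=0\text{ in }A^2(\mathcal{M})\otimes\mathbb{F}_3\}$ and $B_{\mathbb{F}_3}(\mathcal{M})=\mathbb{F}_3\cdot\sigma$ (constant functions). One has $\lambda_{\mathbb{F}_3}(\mathcal{N})\in Z_{\mathbb{F}_3}(\mathcal{M})$ for every $3$-net $\mathcal{N}$. *)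

theory Defs
  imports
    "HOL-Library.Poly_Mapping"
    "HOL-Library.Numeral_Type"
    "Jordan_Normal_Form.Matrix"
begin

section \<open>Matroids and their flats\<close>

record 'a matroid =
  ground :: "'a set"
  indep :: "'a set \<Rightarrow> bool"

locale matroid =
  fixes M :: "'a matroid"
  assumes finite_ground: "finite (ground M)"
    and indep_subset_ground: "indep M S \<Longrightarrow> S \<subseteq> ground M"
    and indep_empty: "indep M {}"
    and indep_mono: "indep M S \<Longrightarrow> T \<subseteq> S \<Longrightarrow> indep M T"
    and augment: "indep M S \<Longrightarrow> indep M T \<Longrightarrow> card S < card T \<Longrightarrow>
      \<exists>x\<in>T - S. indep M (insert x S)"

definition simple :: "'a matroid \<Rightarrow> bool" where
  "simple M \<longleftrightarrow> (\<forall>S\<subseteq>ground M. card S \<le> 2 \<longrightarrow> indep M S)"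

definition circuit :: "'a matroid \<Rightarrow> 'a set \<Rightarrow> bool" where
  "circuit M S \<longleftrightarrow> S \<subseteq> ground M \<and> \<not> indep M S \<and> (\<forall>T. T \<subset> S \<longrightarrow> indep M T)"

definition mrank :: "'a matroid \<Rightarrow> 'a set \<Rightarrow> nat" where
  "mrank M S = Max (card ` {T. T \<subseteq> S \<and> indep M T})"

definition mspan :: "'a matroid \<Rightarrow> 'a set \<Rightarrow> 'a set" where
  "mspan M S = {x \<in> ground M. mrank M (insert x S) = mrank M S}"

definition flats :: "'a matroid \<Rightarrow> 'a set set" where
  "flats M = {F. F \<subseteq> ground M \<and> mspan M F = F}"

definition flats_of_rank :: "'a matroid \<Rightarrow> nat \<Rightarrow> 'a set set" where
  "flats_of_rank M r = {F \<in> flats M. mrank M F = r}"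

abbreviation flat_join :: "'a matroid \<Rightarrow> 'a \<Rightarrow> 'a \<Rightarrow> 'a set" where
  "flat_join M u v \<equiv> mspan M {u, v}"


section \<open>Complex arrangements and realizability\<close>

definition hyperplanes :: "nat \<Rightarrow> complex vec set set" where
  "hyperplanes l = {{x \<in> carrier_vec l. a \<bullet> x = 0} | a. a \<in> carrier_vec l \<and> a \<noteq> 0\<^sub>v l}"

definition central_arrangement :: "nat \<Rightarrow> complex vec set set \<Rightarrow> bool" where
  "central_arrangement l \<A> \<longleftrightarrow> finite \<A> \<and> \<A> \<subseteq> hyperplanes l"

text \<open>The empty subarrangement contributes the whole space, the bottom of the lattice.\<close>

definition intersection_lattice :: "nat \<Rightarrow> complex vec set set \<Rightarrow> complex vec set set" where
  "intersection_lattice l \<A> = {carrier_vec l \<inter> \<Inter>\<B> | \<B>. \<B> \<subseteq> \<A>}"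

text \<open>A lattice isomorphism is the same as an order isomorphism, and it automatically carries the
  rank of a flat to the codimension of the corresponding intersection.\<close>

definition realizable_over_complex :: "'a matroid \<Rightarrow> bool" where
  "realizable_over_complex M \<longleftrightarrow>
    (\<exists>l \<A> \<phi>. central_arrangement l \<A> \<and>
      bij_betw \<phi> (flats M) (intersection_lattice l \<A>) \<and>
      (\<forall>F\<in>flats M. \<forall>G\<in>flats M. F \<subseteq> G \<longleftrightarrow> \<phi> F \<supseteq> \<phi> G))"


section \<open>Multinets and nets\<close>

text \<open>The classes of a multinet are labelled by the elements of the finite type \<open>'k\<close>; the number
  of classes is its cardinality. Multiplicities are only relevant on the ground set.\<close>

record ('a, 'k) multinet =
  cls :: "'k \<Rightarrow> 'a set"
  multip :: "'a \<Rightarrow> nat"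
  base_locus :: "'a set set"

definition labelled_partition :: "'a set \<Rightarrow> ('k \<Rightarrow> 'a set) \<Rightarrow> bool" where
  "labelled_partition A P \<longleftrightarrow>
    (\<forall>\<alpha>. P \<alpha> \<noteq> {}) \<and> (\<forall>\<alpha> \<beta>. \<alpha> \<noteq> \<beta> \<longrightarrow> P \<alpha> \<inter> P \<beta> = {}) \<and> (\<Union>\<alpha>. P \<alpha>) = A"

definition is_multinet :: "'a matroid \<Rightarrow> ('a, 'k::finite) multinet \<Rightarrow> bool" where
  "is_multinet M N \<longleftrightarrow>
    CARD('k) \<ge> 3 \<and>
    labelled_partition (ground M) (cls N) \<and>
    (\<forall>u\<in>ground M. multip N u > 0) \<and>
    base_locus N \<subseteq> flats_of_rank M 2 \<and>
    (\<forall>X\<in>base_locus N. card X > 2) \<and>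
    (\<forall>\<alpha> \<beta>. (\<Sum>u\<in>cls N \<alpha>. multip N u) = (\<Sum>u\<in>cls N \<beta>. multip N u)) \<and>
    (\<forall>\<alpha> \<beta>. \<alpha> \<noteq> \<beta> \<longrightarrow> (\<forall>u\<in>cls N \<alpha>. \<forall>v\<in>cls N \<beta>. flat_join M u v \<in> base_locus N)) \<and>
    (\<forall>X\<in>base_locus N. \<forall>\<alpha> \<beta>.
      (\<Sum>u\<in>cls N \<alpha> \<inter> X. multip N u) = (\<Sum>u\<in>cls N \<beta> \<inter> X. multip N u)) \<and>
    (\<forall>\<alpha>. \<forall>u\<in>cls N \<alpha>. \<forall>v\<in>cls N \<alpha>. \<exists>(p :: nat \<Rightarrow> 'a) r.
      p 0 = u \<and> p r = v \<and> (\<forall>i\<le>r. p i \<in> ground M) \<and>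
      (\<forall>i<r. flat_join M (p i) (p (Suc i)) \<notin> base_locus N))"

definition is_net :: "'a matroid \<Rightarrow> ('a, 'k::finite) multinet \<Rightarrow> bool" where
  "is_net M N \<longleftrightarrow>
    is_multinet M N \<and> (\<forall>X\<in>base_locus N. \<forall>\<alpha>. (\<Sum>u\<in>cls N \<alpha> \<inter> X. multip N u) = 1)"


section \<open>The Orlik--Solomon algebra\<close>

text \<open>Elements of the tensor algebra on generators \<open>e_u\<close> over a commutative ring are finitely
  supported functions on words. The Orlik--Solomon algebra with coefficients in \<open>'r\<close> is presented
  as the quotient of the tensor algebra of the free module on the ground set by \<open>os_ideal\<close>, which
  is generated by the exterior relations \<open>x x = 0\<close> (\<open>x\<close> of degree one) and by \<open>\<partial> e_S\<close> for \<open>S\<close> a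
  circuit. By right exactness of the tensor product this is \<open>A(M) \<otimes> 'r\<close>; the integral algebra is
  the case \<open>'r = int\<close>.\<close>

type_synonym ('a, 'r) tens = "'a list \<Rightarrow>\<^sub>0 'r"

definition tmult :: "('a, 'r::comm_ring_1) tens \<Rightarrow> ('a, 'r) tens \<Rightarrow> ('a, 'r) tens" where
  "tmult f g =
    (\<Sum>v\<in>Poly_Mapping.keys f. \<Sum>w\<in>Poly_Mapping.keys g.
      Poly_Mapping.single (v @ w) (Poly_Mapping.lookup f v * Poly_Mapping.lookup g w))"

abbreviation word :: "'a list \<Rightarrow> ('a, 'r::comm_ring_1) tens" where
  "word w \<equiv> Poly_Mapping.single w 1"

definition tens_algebra :: "'a set \<Rightarrow> ('a, 'r::comm_ring_1) tens set" where
  "tens_algebra A = {f. Poly_Mapping.keys f \<subseteq> lists A}"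

definition deg1 :: "'a set \<Rightarrow> ('a \<Rightarrow> 'r) \<Rightarrow> ('a, 'r::comm_ring_1) tens" where
  "deg1 A \<tau> = (\<Sum>u\<in>A. Poly_Mapping.single [u] (\<tau> u))"

text \<open>On words, the graded derivation of degree \<open>-1\<close> with \<open>\<partial> e_u = 1\<close>.\<close>

primrec boundary :: "'a list \<Rightarrow> ('a, 'r::comm_ring_1) tens" where
  "boundary [] = 0"
| "boundary (u # w) = word w - tmult (word [u]) (boundary w)"

text \<open>All enumerations of a circuit are admitted in place of a fixed linear order on the ground
  set; modulo the exterior relations they give the same element up to sign.\<close>

inductive_set os_ideal :: "'a matroid \<Rightarrow> ('a, 'r::comm_ring_1) tens set" for M where
  exterior: "tmult (deg1 (ground M) \<tau>) (deg1 (ground M) \<tau>) \<in> os_ideal M"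
| circuit: "distinct xs \<Longrightarrow> circuit M (set xs) \<Longrightarrow> boundary xs \<in> os_ideal M"
| zero: "0 \<in> os_ideal M"
| add: "f \<in> os_ideal M \<Longrightarrow> g \<in> os_ideal M \<Longrightarrow> f + g \<in> os_ideal M"
| left: "f \<in> os_ideal M \<Longrightarrow> g \<in> tens_algebra (ground M) \<Longrightarrow> tmult g f \<in> os_ideal M"
| right: "f \<in> os_ideal M \<Longrightarrow> g \<in> tens_algebra (ground M) \<Longrightarrow> tmult f g \<in> os_ideal M"


section \<open>Cocycles, coboundaries and the classes of nets\<close>

text \<open>The space of \<open>'r\<close>-valued functions on the ground set, that is, the degree-one part of the
  Orlik--Solomon algebra of a simple matroid; such functions vanish off the ground set.\<close>

definition funs_on :: "'a matroid \<Rightarrow> ('a \<Rightarrow> 'r::comm_ring_1) set" where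
  "funs_on M = {\<tau>. \<forall>u. u \<notin> ground M \<longrightarrow> \<tau> u = 0}"

definition os_Z :: "'a matroid \<Rightarrow> ('a \<Rightarrow> 'r::comm_ring_1) set" where
  "os_Z M = {\<tau> \<in> funs_on M.
    tmult (deg1 (ground M) (\<lambda>_. 1)) (deg1 (ground M) \<tau>) \<in> os_ideal M}"

definition os_B :: "'a matroid \<Rightarrow> ('a \<Rightarrow> 'r::comm_ring_1) set" where
  "os_B M = {(\<lambda>u. if u \<in> ground M then c else 0) | c. True}"

text \<open>Linear independence of the family of classes of \<open>vs\<close> in the quotient \<open>Z / B\<close>.\<close>

definition lin_indep_quot :: "('a \<Rightarrow> 'r::comm_ring_1) set \<Rightarrow> ('a \<Rightarrow> 'r) set \<Rightarrow> ('a \<Rightarrow> 'r) list \<Rightarrow> bool"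
  where
  "lin_indep_quot Z B vs \<longleftrightarrow>
    set vs \<subseteq> Z \<and>
    (\<forall>c :: nat \<Rightarrow> 'r. (\<lambda>u. \<Sum>i<length vs. c i * (vs ! i) u) \<in> B \<longrightarrow> (\<forall>i<length vs. c i = 0))"

text \<open>The type \<open>3\<close> is the ring of integers modulo 3; it serves both as the field of coefficients
  and as the set of labels of a 3-net.\<close>

definition net_fun :: "'a matroid \<Rightarrow> ('a, 3) multinet \<Rightarrow> 'a \<Rightarrow> 3" where
  "net_fun M N u = (if u \<in> ground M then THE \<alpha>. u \<in> cls N \<alpha> else 0)"


section \<open>The function of a 3-net is a cocycle\<close>

text \<open>This shows that the membership requirement in \<^const>\<open>lin_indep_quot\<close> is automatic for
  the functions attached to 3-nets.\<close>

lemma tmult_superset: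
  assumes "finite A" "finite B" "Poly_Mapping.keys f \<subseteq> A" "Poly_Mapping.keys g \<subseteq> B"
  shows "tmult f g =
    (\<Sum>v\<in>A. \<Sum>w\<in>B. Poly_Mapping.single (v @ w) (Poly_Mapping.lookup f v * Poly_Mapping.lookup g w))"
proof -
  have "(\<Sum>w\<in>B. Poly_Mapping.single (v @ w) (Poly_Mapping.lookup f v * Poly_Mapping.lookup g w)) =
    (\<Sum>w\<in>Poly_Mapping.keys g. Poly_Mapping.single (v @ w) (Poly_Mapping.lookup f v * Poly_Mapping.lookup g w))" for v
    by (rule sum.mono_neutral_right) (use assms in \<open>auto simp: in_keys_iff\<close>)
  moreover have "tmult f g = (\<Sum>v\<in>A. \<Sum>w\<in>Poly_Mapping.keys g.
      Poly_Mapping.single (v @ w) (Poly_Mapping.lookup f v * Poly_Mapping.lookup g w))"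
    unfolding tmult_def
    by (rule sum.mono_neutral_left) (use assms in \<open>auto simp: in_keys_iff\<close>)
  ultimately show ?thesis by simp
qed

lemma tmult_add_left: "tmult (f + f') g = tmult f g + tmult f' g"
proof -
  let ?A = "Poly_Mapping.keys f \<union> Poly_Mapping.keys f'"
  have "Poly_Mapping.keys (f + f') \<subseteq> ?A" by (rule Poly_Mapping.keys_add)
  then show ?thesis
    by (simp add: tmult_superset[where A = ?A and B = "Poly_Mapping.keys g"]
        lookup_add algebra_simps single_add sum.distrib)
qed

lemma tmult_add_right: "tmult f (g + g') = tmult f g + tmult f g'"
proof -
  let ?B = "Poly_Mapping.keys g \<union> Poly_Mapping.keys g'"
  have "Poly_Mapping.keys (g + g') \<subseteq> ?B" by (rule Poly_Mapping.keys_add)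
  then show ?thesis
    by (simp add: tmult_superset[where A = "Poly_Mapping.keys f" and B = ?B]
        lookup_add algebra_simps single_add sum.distrib)
qed

lemma tmult_single: "tmult (Poly_Mapping.single v a) (Poly_Mapping.single w b) =
    Poly_Mapping.single (v @ w) (a * b)"
  by (subst tmult_superset[where A = "{v}" and B = "{w}"]) auto

lemma tmult_zero [simp]: "tmult 0 g = 0" "tmult f 0 = 0"
  by (simp_all add: tmult_def)

lemma tmult_diff_right: "tmult f (g - g') = tmult f g - tmult f g'"
  using tmult_add_right[of f "g - g'" g'] by simp

lemma tmult_sum_left: "tmult (\<Sum>x\<in>A. F x) g = (\<Sum>x\<in>A. tmult (F x) g)"
  by (induction A rule: infinite_finite_induct) (simp_all add: tmult_add_left)

lemma tmult_sum_right: "tmult f (\<Sum>x\<in>A. F x) = (\<Sum>x\<in>A. tmult f (F x))"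
  by (induction A rule: infinite_finite_induct) (simp_all add: tmult_add_right)

lemma boundary_3: "boundary [u, v, w] = word [v, w] - word [u, w] + word [u, v]"
  by (simp add: tmult_diff_right tmult_single)

lemma tmult_one: "tmult (word []) f = f"
proof (rule poly_mapping_eqI)
  fix k
  have "tmult (word []) f =
    (\<Sum>w\<in>Poly_Mapping.keys f. Poly_Mapping.single w (Poly_Mapping.lookup f w))"
    by (subst tmult_superset[where A = "{[]}" and B = "Poly_Mapping.keys f"]) auto
  then show "Poly_Mapping.lookup (tmult (word []) f) k = Poly_Mapping.lookup f k"
    by (simp add: lookup_sum lookup_single when_def in_keys_iff)
qed

lemma os_ideal_uminus:
  assumes "f \<in> os_ideal M"
  shows "- f \<in> os_ideal M"
proof -
  have "tmult (Poly_Mapping.single [] (-1)) f \<in> os_ideal M"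
    by (rule os_ideal.left[OF assms]) (simp add: tens_algebra_def)
  moreover have "tmult (Poly_Mapping.single [] (-1)) f + tmult (word []) f = 0"
    by (simp flip: tmult_add_left single_add)
  then have "tmult (Poly_Mapping.single [] (-1)) f = - f"
    by (simp add: tmult_one eq_neg_iff_add_eq_0)
  ultimately show ?thesis by simp
qed

lemma os_ideal_diff: "f \<in> os_ideal M \<Longrightarrow> g \<in> os_ideal M \<Longrightarrow> f - g \<in> os_ideal M"
  using os_ideal.add[of f M "- g"] os_ideal_uminus[of g M] by simp

lemma os_ideal_sum: "(\<And>x. x \<in> A \<Longrightarrow> F x \<in> os_ideal M) \<Longrightarrow> (\<Sum>x\<in>A. F x) \<in> os_ideal M"
  by (induction A rule: infinite_finite_induct) (auto intro: os_ideal.zero os_ideal.add)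

lemma type3_cases: "(x::3) = 0 \<or> x = 1 \<or> x = 2"
proof -
  obtain z where z: "x = of_int z" "0 \<le> z" "z < int CARD(3)"
    by (cases x rule: bit1_cases) simp
  then have "z = 0 \<or> z = 1 \<or> z = 2" by auto
  with z show ?thesis by auto
qed

lemma type3_neq: "(0::3) \<noteq> 1" "(0::3) \<noteq> 2" "(1::3) \<noteq> 2" "(1::3) \<noteq> 0" "(2::3) \<noteq> 0" "(2::3) \<noteq> 1"
  by simp_all

lemma tens3_triple: "f + f + f = (0 :: ('a, 3) tens)"
proof (rule poly_mapping_eqI)
  fix k
  have "(1::3) + 1 + 1 = 0" "(2::3) + 2 + 2 = 0" by simp_all
  then show "Poly_Mapping.lookup (f + f + f) k = Poly_Mapping.lookup 0 k"
    using type3_cases[of "Poly_Mapping.lookup f k"] by (auto simp: lookup_add)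
qed

context matroid
begin

lemma mrank_ge:
  assumes "T \<subseteq> S" "indep M T"
  shows "card T \<le> mrank M S"
  unfolding mrank_def
proof (rule Max_ge)
  have "{T. T \<subseteq> S \<and> indep M T} \<subseteq> Pow (ground M)" using indep_subset_ground by auto
  then show "finite (card ` {T. T \<subseteq> S \<and> indep M T})"
    using finite_ground by (auto intro: finite_subset)
qed (use assms in auto)

lemma mrank_le:
  assumes "\<And>T. T \<subseteq> S \<Longrightarrow> indep M T \<Longrightarrow> card T \<le> r"
  shows "mrank M S \<le> r"
  unfolding mrank_def
proof (rule Max.boundedI)
  have "{T. T \<subseteq> S \<and> indep M T} \<subseteq> Pow (ground M)" using indep_subset_ground by auto
  then show "finite (card ` {T. T \<subseteq> S \<and> indep M T})"
    using finite_ground by (auto intro: finite_subset)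
qed (use assms indep_empty in auto)

lemma join_iff:
  assumes "simple M" "distinct [u, v, w]" "{u, v, w} \<subseteq> ground M"
  shows "w \<in> flat_join M u v \<longleftrightarrow> \<not> indep M {u, v, w}"
proof -
  have c: "card {u, v} = 2" "card {w, u, v} = 3" "{u, v, w} = {w, u, v}" using assms(2) by auto
  have "indep M {u, v}" using assms(1,3) c unfolding simple_def by simp
  then have ge: "mrank M {u, v} \<ge> 2" "mrank M {w, u, v} \<ge> 2"
    using mrank_ge[of "{u, v}" "{u, v}"] mrank_ge[of "{u, v}" "{w, u, v}"] c by auto
  have "mrank M {u, v} \<le> 2"
    by (rule mrank_le) (use c card_mono[of "{u, v}"] in auto)
  then have r2: "mrank M {u, v} = 2" using ge by simp
  show ?thesis
  proof (cases "indep M {u, v, w}")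
    case True
    then have "3 \<le> mrank M {w, u, v}"
      using mrank_ge[of "{w, u, v}" "{w, u, v}"] c by simp
    then show ?thesis using True r2 by (simp add: mspan_def)
  next
    case False
    have "mrank M {w, u, v} \<le> 2"
    proof (rule mrank_le)
      fix T assume T: "T \<subseteq> {w, u, v}" "indep M T"
      then have "T \<noteq> {w, u, v}" using False c(3) by auto
      then have "card T < card {w, u, v}" using T by (intro psubset_card_mono) auto
      then show "card T \<le> 2" unfolding c by simp
    qed
    then show ?thesis using False r2 ge assms(3) by (simp add: mspan_def)
  qed
qed

lemma net_third_point:
  fixes N :: "('a, 3) multinet"
  assumes "simple M" "is_net M N" "\<alpha> \<noteq> \<beta>" "\<gamma> \<noteq> \<alpha>" "\<gamma> \<noteq> \<beta>" "u \<in> cls N \<alpha>" "v \<in> cls N \<beta>"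
  shows "\<exists>!w. w \<in> cls N \<gamma> \<and> \<not> indep M {u, v, w}"
proof -
  have part: "labelled_partition (ground M) (cls N)"
    and m: "\<And>u. u \<in> ground M \<Longrightarrow> multip N u > 0"
    and X: "flat_join M u v \<in> base_locus N"
    using assms unfolding is_net_def is_multinet_def by auto
  let ?C = "cls N \<gamma> \<inter> flat_join M u v"
  have sub: "cls N \<delta> \<subseteq> ground M" for \<delta> using part by (auto simp: labelled_partition_def)
  have fin: "finite ?C" using finite_subset[OF sub finite_ground] by auto
  have one: "(\<Sum>u\<in>?C. multip N u) = 1" using assms(2) X unfolding is_net_def by auto
  have "card ?C = 1"
  proof -
    have "card ?C \<le> (\<Sum>u\<in>?C. multip N u)"
    proof -
      have "card ?C = (\<Sum>u\<in>?C. 1)" by simp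
      also have "\<dots> \<le> (\<Sum>u\<in>?C. multip N u)"
        by (rule sum_mono) (use m sub in \<open>auto simp: Suc_le_eq\<close>)
      finally show ?thesis .
    qed
    moreover have "?C \<noteq> {}" using one by force
    ultimately show ?thesis using one fin by (simp add: card_gt_0_iff le_antisym Suc_le_eq)
  qed
  then obtain w where w: "?C = {w}" by (auto simp: card_1_singleton_iff)
  have "\<not> indep M {u, v, x} \<longleftrightarrow> x \<in> flat_join M u v" if "x \<in> cls N \<gamma>" for x
  proof (rule join_iff[OF assms(1), symmetric])
    show "distinct [u, v, x]" using part assms that by (auto simp: labelled_partition_def)
    show "{u, v, x} \<subseteq> ground M" using sub assms that by auto
  qed
  then have "w' \<in> cls N \<gamma> \<and> \<not> indep M {u, v, w'} \<longleftrightarrow> w' \<in> ?C" for w'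
    by auto
  then show ?thesis unfolding w by simp
qed

theorem net_fun_in_os_Z:
  fixes N :: "('a, 3) multinet"
  assumes "simple M" "is_net M N"
  shows "net_fun M N \<in> os_Z M"
proof -
  have part: "labelled_partition (ground M) (cls N)"
    using assms unfolding is_net_def is_multinet_def by auto
  have sub: "cls N \<delta> \<subseteq> ground M" for \<delta> using part by (auto simp: labelled_partition_def)
  have disj: "\<delta> = \<epsilon>" if "u \<in> cls N \<delta>" "u \<in> cls N \<epsilon>" for u \<delta> \<epsilon>
    using part that by (auto simp: labelled_partition_def)
  have ex: "\<exists>\<delta>. u \<in> cls N \<delta>" if "u \<in> ground M" for u
    using part that by (simp add: labelled_partition_def) blast
  have mem: "u \<in> cls N \<epsilon> \<longleftrightarrow> \<epsilon> = \<delta>" if "u \<in> cls N \<delta>" for u \<delta> \<epsilon>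
    using that disj by blast
  have val: "net_fun M N u = \<delta>" if "u \<in> cls N \<delta>" for u \<delta>
    using that subsetD[OF sub that] by (auto simp: net_fun_def mem[OF that])
  define x where "x \<delta> = (\<Sum>u\<in>cls N \<delta>. word [u] :: ('a, 3) tens)" for \<delta>
  define W where "W \<delta> \<epsilon> = tmult (x \<delta>) (x \<epsilon>)" for \<delta> \<epsilon>
  have W: "W \<delta> \<epsilon> = (\<Sum>(u, v)\<in>cls N \<delta> \<times> cls N \<epsilon>. word [u, v])" for \<delta> \<epsilon>
    unfolding W_def x_def tmult_sum_left
    by (simp add: tmult_sum_right tmult_single sum.cartesian_product)
  have x_deg1: "x \<delta> = deg1 (ground M) (\<lambda>u. if u \<in> cls N \<delta> then 1 else 0)" for \<delta>
    unfolding x_def deg1_def by (rule sum.mono_neutral_cong_left) (use finite_ground sub in auto)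
  have add_deg1: "deg1 A \<sigma> + deg1 A \<tau> = deg1 A (\<lambda>u. \<sigma> u + \<tau> u)" for A and \<sigma> \<tau> :: "'a \<Rightarrow> 3"
    by (simp add: deg1_def single_add sum.distrib)
  have diag: "W \<delta> \<delta> \<in> os_ideal M" for \<delta>
    unfolding W_def x_deg1 by (rule os_ideal.exterior)
  have anti: "W \<delta> \<epsilon> + W \<epsilon> \<delta> \<in> os_ideal M" for \<delta> \<epsilon>
  proof -
    have "tmult (x \<delta> + x \<epsilon>) (x \<delta> + x \<epsilon>) \<in> os_ideal M"
      unfolding x_deg1 add_deg1 by (rule os_ideal.exterior)
    then have "tmult (x \<delta> + x \<epsilon>) (x \<delta> + x \<epsilon>) - W \<delta> \<delta> - W \<epsilon> \<epsilon> \<in> os_ideal M"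
      by (intro os_ideal_diff diag)
    then show ?thesis by (simp add: W_def tmult_add_left tmult_add_right algebra_simps)
  qed
  have one: "deg1 (ground M) (\<lambda>_. 1) = x 0 + x 1 + x 2"
    unfolding x_deg1 add_deg1 unfolding deg1_def
  proof (rule sum.cong[OF refl], rule arg_cong[of _ _ "Poly_Mapping.single _"])
    fix u assume "u \<in> ground M"
    then obtain \<delta> where "u \<in> cls N \<delta>" using ex by blast
    then show "(1::3) = (if u \<in> cls N 0 then 1 else 0) +
        (if u \<in> cls N 1 then 1 else 0) + (if u \<in> cls N 2 then 1 else 0)"
      using type3_cases[of \<delta>] by (auto simp only: mem type3_neq if_True if_False) simp_all
  qed
  have lam: "deg1 (ground M) (net_fun M N) = x 1 + x 2 + x 2"
    unfolding x_deg1 add_deg1 unfolding deg1_def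
  proof (rule sum.cong[OF refl], rule arg_cong[of _ _ "Poly_Mapping.single _"])
    fix u assume "u \<in> ground M"
    then obtain \<delta> where "u \<in> cls N \<delta>" using ex by blast
    then show "net_fun M N u = (if u \<in> cls N 1 then 1 else 0) +
        (if u \<in> cls N 2 then 1 else 0) + (if u \<in> cls N 2 then 1 else 0)"
      using type3_cases[of \<delta>] by (auto simp only: mem val type3_neq if_True if_False) simp_all
  qed
  define T where "T = {(u, v, w). u \<in> cls N 0 \<and> v \<in> cls N 1 \<and> w \<in> cls N 2 \<and> \<not> indep M {u, v, w}}"
  have b01: "bij_betw (\<lambda>(u, v, w). (u, v)) T (cls N 0 \<times> cls N 1)"
  proof -
    have *: "\<exists>!w. w \<in> cls N 2 \<and> \<not> indep M {u, v, w}" if "u \<in> cls N 0" "v \<in> cls N 1" for u v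
      by (rule net_third_point[OF assms, where \<alpha> = 0 and \<beta> = 1]) (use that in auto)
    show ?thesis
    proof (rule bij_betw_imageI)
      show "inj_on (\<lambda>(u, v, w). (u, v)) T"
        unfolding inj_on_def T_def by clarify (use * in blast)
      show "(\<lambda>(u, v, w). (u, v)) ` T = cls N 0 \<times> cls N 1"
      proof (intro equalityI subsetI)
        fix p assume "p \<in> cls N 0 \<times> cls N 1"
        then obtain u v w where "p = (u, v)" "(u, v, w) \<in> T"
          using * by (force simp: T_def)
        then show "p \<in> (\<lambda>(u, v, w). (u, v)) ` T" by force
      qed (auto simp: T_def)
    qed
  qed
  have b12: "bij_betw (\<lambda>(u, v, w). (v, w)) T (cls N 1 \<times> cls N 2)"
  proof -
    have *: "\<exists>!u. u \<in> cls N 0 \<and> \<not> indep M {u, v, w}" if "v \<in> cls N 1" "w \<in> cls N 2" for v w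
    proof -
      have "\<exists>!u. u \<in> cls N 0 \<and> \<not> indep M {v, w, u}"
        by (rule net_third_point[OF assms, where \<alpha> = 1 and \<beta> = 2]) (use that in auto)
      moreover have "{v, w, u} = {u, v, w}" for u by auto
      ultimately show ?thesis by simp
    qed
    show ?thesis
    proof (rule bij_betw_imageI)
      show "inj_on (\<lambda>(u, v, w). (v, w)) T"
        unfolding inj_on_def T_def by clarify (use * in blast)
      show "(\<lambda>(u, v, w). (v, w)) ` T = cls N 1 \<times> cls N 2"
      proof (intro equalityI subsetI)
        fix p assume "p \<in> cls N 1 \<times> cls N 2"
        then obtain u v w where "p = (v, w)" "(u, v, w) \<in> T"
          using * by (force simp: T_def)
        then show "p \<in> (\<lambda>(u, v, w). (v, w)) ` T" by force
      qed (auto simp: T_def)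
    qed
  qed
  have b02: "bij_betw (\<lambda>(u, v, w). (u, w)) T (cls N 0 \<times> cls N 2)"
  proof -
    have *: "\<exists>!v. v \<in> cls N 1 \<and> \<not> indep M {u, v, w}" if "u \<in> cls N 0" "w \<in> cls N 2" for u w
    proof -
      have "\<exists>!v. v \<in> cls N 1 \<and> \<not> indep M {u, w, v}"
        by (rule net_third_point[OF assms, where \<alpha> = 0 and \<beta> = 2]) (use that in auto)
      moreover have "{u, w, v} = {u, v, w}" for v by auto
      ultimately show ?thesis by simp
    qed
    show ?thesis
    proof (rule bij_betw_imageI)
      show "inj_on (\<lambda>(u, v, w). (u, w)) T"
        unfolding inj_on_def T_def by clarify (use * in blast)
      show "(\<lambda>(u, v, w). (u, w)) ` T = cls N 0 \<times> cls N 2"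
      proof (intro equalityI subsetI)
        fix p assume "p \<in> cls N 0 \<times> cls N 2"
        then obtain u v w where "p = (u, w)" "(u, v, w) \<in> T"
          using * by (force simp: T_def)
        then show "p \<in> (\<lambda>(u, v, w). (u, w)) ` T" by force
      qed (auto simp: T_def)
    qed
  qed
  have W01: "W 0 1 = (\<Sum>(u, v, w)\<in>T. word [u, v])"
    unfolding W sum.reindex_bij_betw[OF b01, symmetric] by (simp add: case_prod_beta)
  have W12: "W 1 2 = (\<Sum>(u, v, w)\<in>T. word [v, w])"
    unfolding W sum.reindex_bij_betw[OF b12, symmetric] by (simp add: case_prod_beta)
  have W02: "W 0 2 = (\<Sum>(u, v, w)\<in>T. word [u, w])"
    unfolding W sum.reindex_bij_betw[OF b02, symmetric] by (simp add: case_prod_beta)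
  have "(\<Sum>(u, v, w)\<in>T. boundary [u, v, w] :: ('a, 3) tens) \<in> os_ideal M"
  proof (rule os_ideal_sum, clarify)
    fix u v w assume "(u, v, w) \<in> T"
    then have uvw: "u \<in> cls N 0" "v \<in> cls N 1" "w \<in> cls N 2" "\<not> indep M {u, v, w}"
      by (auto simp: T_def)
    then have d: "distinct [u, v, w]" using disj by fastforce
    have "circuit M (set [u, v, w])"
      unfolding circuit_def
    proof (intro conjI allI impI)
      show gr: "set [u, v, w] \<subseteq> ground M" using uvw sub by auto
      fix S assume S: "S \<subset> set [u, v, w]"
      then have "card S < card (set [u, v, w])" by (intro psubset_card_mono) auto
      then have "card S \<le> 2" using d by simp
      moreover have "S \<subseteq> ground M" using S gr by blast
      ultimately show "indep M S" using assms(1) unfolding simple_def by simp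
    qed (use uvw in simp)
    then show "boundary [u, v, w] \<in> (os_ideal M :: ('a, 3) tens set)"
      by (rule os_ideal.circuit[OF d])
  qed
  also have "(\<Sum>(u, v, w)\<in>T. boundary [u, v, w] :: ('a, 3) tens) = W 1 2 - W 0 2 + W 0 1"
    unfolding W01 W12 W02 boundary_3 by (simp add: case_prod_beta sum.distrib sum_subtractf)
  finally have bd: "W 1 2 - W 0 2 + W 0 1 \<in> os_ideal M" .
  have "(W 1 2 - W 0 2 + W 0 1) + (W 1 1 + W 2 2 + W 2 2 + (W 2 1 + W 1 2)) \<in> os_ideal M"
    by (intro os_ideal.add bd diag anti)
  also have "(W 1 2 - W 0 2 + W 0 1) + (W 1 1 + W 2 2 + W 2 2 + (W 2 1 + W 1 2)) =
      tmult (x 0 + x 1 + x 2) (x 1 + x 2 + x 2) - (W 0 2 + W 0 2 + W 0 2)"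
    by (simp add: W_def tmult_add_left tmult_add_right algebra_simps)
  finally have "tmult (x 0 + x 1 + x 2) (x 1 + x 2 + x 2) \<in> os_ideal M"
    by (simp add: tens3_triple)
  then show ?thesis
    by (simp add: os_Z_def one lam funs_on_def net_fun_def)
qed

end

end

theory Submission
  imports Defs "HOL-Computational_Algebra.Polynomial" "HOL-Library.Product_Plus"
begin

text \<open>The labels of the three nets combine to a map \<open>\<Lambda>\<close> from the ground set to \<open>\<int>\<^sub>3\<^sup>3\<close>. Two points with
  distinct labels \<open>x\<close>, \<open>y\<close> span a flat with exactly three points, the third one having label
  \<open>- x - y\<close>; hence, by linear independence, a translate of \<open>\<Lambda>\<close> maps onto a subgroup containing
  affine 3-space. If the matroid is realized by linear forms, let \<open>q x\<close> be the product of the forms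
  with label \<open>x\<close>. Then \<open>q x\<close>, \<open>q y\<close>, \<open>q (- x - y)\<close> lie in a pencil, while
  \<open>q x\<close>, \<open>q y\<close>, \<open>q z\<close> are linearly independent if \<open>x\<close>, \<open>y\<close>, \<open>z\<close> are not collinear, so
  the \<open>q x\<close> realize affine 3-space over three elements in a complex vector space. There every plane becomes
  a Hesse configuration, which is determined up to a choice of a primitive cube root of unity, and
  these choices cannot be made compatibly for all planes through a point.\<close>

section \<open>Products of linear forms\<close>

text \<open>Forms are taken on all of \<open>nat => complex\<close>, so that no dimension or carrier
  set has to be carried along. The one identity contains homogeneity as well: taking
  \<open>p\<close> and \<open>r\<close> zero and \<open>t = 1\<close> forces the value 0 at the
  origin.\<close>

definition linear_form :: "((nat \<Rightarrow> complex) \<Rightarrow> complex) \<Rightarrow> bool" where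
  "linear_form f \<longleftrightarrow> (\<forall>p t r. f (\<lambda>i. p i + t * r i) = f p + t * f r)"

lemma linear_formD: "linear_form f \<Longrightarrow> f (\<lambda>i. p i + t * r i) = f p + t * f r"
  by (simp add: linear_form_def)

lemma linear_form_scale: "linear_form f \<Longrightarrow> linear_form (\<lambda>p. c * f p)"
  by (simp add: linear_form_def algebra_simps)

lemma linear_form_diff: "linear_form f \<Longrightarrow> linear_form g \<Longrightarrow> linear_form (\<lambda>p. f p - g p)"
  by (simp add: linear_form_def algebra_simps)

text \<open>A space is not covered by finitely many proper kernels. By induction take
  \<open>p\<close> off the old kernels and \<open>r\<close> off the new one; on the line
  \<open>p + t r\<close> each form has at most one zero, and there are infinitely many parameters
  \<open>t\<close>.\<close>

lemma generic_point:
  fixes f :: "'i \<Rightarrow> (nat \<Rightarrow> complex) \<Rightarrow> complex"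
  assumes "finite I" "W \<noteq> {}"
    and closed: "\<And>p t r. p \<in> W \<Longrightarrow> r \<in> W \<Longrightarrow> (\<lambda>i. p i + t * r i) \<in> W"
    and lin: "\<And>i. i \<in> I \<Longrightarrow> linear_form (f i)"
    and nz: "\<And>i. i \<in> I \<Longrightarrow> \<exists>p\<in>W. f i p \<noteq> 0"
  shows "\<exists>p\<in>W. \<forall>i\<in>I. f i p \<noteq> 0"
  using assms(1) lin nz
proof (induction I rule: finite_induct)
  case empty
  then show ?case using assms(2) by auto
next
  case (insert j I)
  then obtain p where p: "p \<in> W" "\<forall>i\<in>I. f i p \<noteq> 0" by auto
  obtain r where r: "r \<in> W" "f j r \<noteq> 0" using insert.prems(2) by auto
  \<comment> \<open>If \<open>f i r = 0\<close>, the quotient is 0 by convention and excludes only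
    \<open>t = 0\<close>; such a form has the constant value \<open>f i p\<close>, which is nonzero
    for old \<open>i\<close>.\<close>
  let ?Z = "insert (- f j p / f j r) ((\<lambda>i. - f i p / f i r) ` I)"
  have "infinite (UNIV - ?Z :: complex set)"
    by (rule Diff_infinite_finite) (use insert.hyps infinite_UNIV_char_0 in auto)
  then obtain t where t: "t \<notin> ?Z" by (metis DiffD2 equals0I finite.emptyI)
  have "f i (\<lambda>k. p k + t * r k) \<noteq> 0" if "i \<in> insert j I" for i
  proof
    assume "f i (\<lambda>k. p k + t * r k) = 0"
    then have z: "f i p + t * f i r = 0"
      using insert.prems(1)[OF that] by (simp add: linear_formD)
    have "f i r \<noteq> 0" using z p r that by auto
    then have "t = - f i p / f i r" using z by (simp add: field_simps add_eq_0_iff)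
    then show False using t that by auto
  qed
  then show ?case using closed[OF p(1) r(1)] by blast
qed

lemma form_in_span:
  assumes lin: "linear_form f" "linear_form g" "linear_form h"
    and "\<exists>p. f p = 0 \<and> g p \<noteq> 0" "\<exists>p. g p = 0 \<and> f p \<noteq> 0"
    and sub: "\<And>p. f p = 0 \<Longrightarrow> g p = 0 \<Longrightarrow> h p = 0"
  shows "\<exists>c d. \<forall>p. h p = c * g p + d * f p"
proof -
  obtain p r where p: "f p = 0" "g p \<noteq> 0" and r: "g r = 0" "f r \<noteq> 0" using assms by blast
  have "h z = h p / g p * g z + h r / f r * f z" for z
  proof -
    \<comment> \<open>Up to scaling, \<open>p\<close> and \<open>r\<close> are dual to
      \<open>g\<close> and \<open>f\<close>. Removing both components from \<open>z\<close> leaves a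
      point \<open>?w\<close> of the common kernel, where \<open>h\<close> vanishes.\<close>
    let ?y = "\<lambda>i. z i + (- (g z / g p)) * p i"
    let ?w = "\<lambda>i. ?y i + (- (f z / f r)) * r i"
    have e: "k ?w = k z + (- (g z / g p)) * k p + (- (f z / f r)) * k r" if "linear_form k" for k
      by (simp only: linear_formD[OF that])
    have "h ?w = 0" by (rule sub) (simp_all only: e lin, use p r in auto)
    then have "h z + (- (g z / g p)) * h p + (- (f z / f r)) * h r = 0"
      by (simp only: e lin)
    then show ?thesis by (simp add: algebra_simps add_eq_0_iff)
  qed
  then show ?thesis by blast
qed

section \<open>Restriction to lines and the pencil spanned by two products\<close>

lemma prod_on_line:
  assumes "\<And>u. u \<in> A \<Longrightarrow> linear_form (f u)"
  shows "(\<Prod>u\<in>A. f u (\<lambda>i. p i + t * r i)) = poly (\<Prod>u\<in>A. [:f u p, f u r:]) t"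
  using assms by (auto simp: poly_prod linear_formD intro!: prod.cong)

lemma coeff_prod_linear:
  fixes f g :: "'i \<Rightarrow> 'c::idom"
  assumes "finite A"
  shows "degree (\<Prod>u\<in>A. [:f u, 1:]) = card A \<and> coeff (\<Prod>u\<in>A. [:f u, 1:]) (card A) = 1"
proof -
  have "degree (\<Prod>u\<in>A. [:f u, 1:]) = card A" by (subst degree_prod_sum_eq) auto
  moreover have "lead_coeff (\<Prod>u\<in>A. [:f u, 1:]) = 1" by (simp add: lead_coeff_prod)
  ultimately show ?thesis by simp
qed

text \<open>On the hyperplane of \<open>u\<close> in \<open>A\<close> the forms of \<open>C\<close>
  are multiples of those of \<open>B\<close>, so the two products are proportional there. The factor
  does not depend on \<open>u\<close>, hence some combination \<open>F\<close> vanishes on all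
  hyperplanes of \<open>A\<close>; the coefficient of the product over \<open>A\<close> is then
  fixed by the value at \<open>x0\<close>. Univariate polynomials on lines replace divisibility by
  the product over \<open>A\<close>.\<close>

lemma pencil_relation:
  fixes f :: "'a \<Rightarrow> (nat \<Rightarrow> complex) \<Rightarrow> complex"
  assumes fin: "finite A" "finite B" "finite C"
    and card: "card A = card B" "card B = card C" and ne: "A \<noteq> {}"
    and lin: "\<And>u. u \<in> A \<union> B \<union> C \<Longrightarrow> linear_form (f u)"
    and normal: "\<And>u. u \<in> A \<union> B \<union> C \<Longrightarrow> f u x0 = 1"
    and indep2: "\<And>u v. u \<in> A \<union> B \<union> C \<Longrightarrow> v \<in> A \<union> B \<union> C \<Longrightarrow> u \<noteq> v \<Longrightarrow> \<exists>p. f u p = 0 \<and> f v p \<noteq> 0"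
    and disj: "A \<inter> B = {}" "A \<inter> C = {}"
    and third: "\<And>u. u \<in> A \<Longrightarrow> \<exists>\<sigma>. bij_betw \<sigma> B C \<and>
      (\<forall>v\<in>B. \<forall>p. f u p = 0 \<longrightarrow> f v p = 0 \<longrightarrow> f (\<sigma> v) p = 0)"
    and same: "\<And>u u' v. u \<in> A \<Longrightarrow> u' \<in> A \<Longrightarrow> u \<noteq> u' \<Longrightarrow> v \<in> B \<Longrightarrow>
      \<exists>p. f u p = 0 \<and> f u' p = 0 \<and> f v p \<noteq> 0"
  shows "\<exists>c. \<forall>p. (\<Prod>u\<in>C. f u p) = c * (\<Prod>u\<in>B. f u p) + (1 - c) * (\<Prod>u\<in>A. f u p)"
proof -
  have restrict: "\<exists>c. \<forall>p. f u p = 0 \<longrightarrow> (\<Prod>w\<in>C. f w p) = c * (\<Prod>v\<in>B. f v p)" if u: "u \<in> A" for u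
  proof -
    obtain \<sigma> where \<sigma>: "bij_betw \<sigma> B C" "\<forall>v\<in>B. \<forall>p. f u p = 0 \<longrightarrow> f v p = 0 \<longrightarrow> f (\<sigma> v) p = 0"
      using third[OF u] by blast
    have "\<exists>c d. \<forall>p. f (\<sigma> v) p = c * f v p + d * f u p" if v: "v \<in> B" for v
    proof (rule form_in_span)
      show "linear_form (f u)" "linear_form (f v)" "linear_form (f (\<sigma> v))"
        using u v \<sigma>(1) by (auto intro!: lin simp: bij_betw_def)
      show "\<exists>p. f u p = 0 \<and> f v p \<noteq> 0" "\<exists>p. f v p = 0 \<and> f u p \<noteq> 0"
        using u v disj by (auto intro!: indep2)
    qed (use \<sigma> v in auto)
    then obtain c d where cd: "\<And>v p. v \<in> B \<Longrightarrow> f (\<sigma> v) p = c v * f v p + d v * f u p" by metis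
    have "(\<Prod>w\<in>C. f w p) = (\<Prod>v\<in>B. c v) * (\<Prod>v\<in>B. f v p)" if "f u p = 0" for p
    proof -
      have "(\<Prod>w\<in>C. f w p) = (\<Prod>v\<in>B. f (\<sigma> v) p)"
        by (rule prod.reindex_bij_betw[OF \<sigma>(1), symmetric])
      also have "\<dots> = (\<Prod>v\<in>B. c v * f v p)" by (rule prod.cong) (use cd that in auto)
      finally show ?thesis by (simp add: prod.distrib)
    qed
    then show ?thesis by blast
  qed
  then obtain c where c: "\<And>u p. u \<in> A \<Longrightarrow> f u p = 0 \<Longrightarrow> (\<Prod>w\<in>C. f w p) = c u * (\<Prod>v\<in>B. f v p)"
    by metis
  \<comment> \<open>By \<open>same\<close>, the intersection of two hyperplanes of \<open>A\<close>
    has a point off all hyperplanes of \<open>B\<close>; there both relations hold and the product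
    over \<open>B\<close> cancels.\<close>
  have c_const: "c u = c u'" if u: "u \<in> A" "u' \<in> A" for u u'
  proof (cases "u = u'")
    case False
    have l: "linear_form (f u)" "linear_form (f u')" using lin u by auto
    have z: "f u (\<lambda>i. 0) = 0" "f u' (\<lambda>i. 0) = 0"
      using l[THEN linear_formD, of "\<lambda>i. 0" 1 "\<lambda>i. 0"] by auto
    have "\<exists>p\<in>{p. f u p = 0 \<and> f u' p = 0}. \<forall>v\<in>B. f v p \<noteq> 0"
    proof (rule generic_point[OF fin(2)])
      show "{p. f u p = 0 \<and> f u' p = 0} \<noteq> {}" using z by blast
    qed (use same[OF u False] lin l in \<open>auto simp: linear_formD\<close>)
    then obtain p where p: "f u p = 0" "f u' p = 0" "\<forall>v\<in>B. f v p \<noteq> 0" by auto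
    then have "(\<Prod>v\<in>B. f v p) \<noteq> 0" using fin by auto
    moreover have "c u * (\<Prod>v\<in>B. f v p) = c u' * (\<Prod>v\<in>B. f v p)"
      by (rule trans[OF c[OF u(1) p(1), symmetric] c[OF u(2) p(2)]])
    ultimately show ?thesis by simp
  qed simp
  obtain u0 where u0: "u0 \<in> A" using ne by auto
  define k where "k = c u0"
  have k: "(\<Prod>w\<in>C. f w p) = k * (\<Prod>v\<in>B. f v p)" if "u \<in> A" "f u p = 0" for u p
    using c[OF that] c_const[OF that(1) u0] by (simp add: k_def)
  \<comment> \<open>All three products equal 1 at \<open>x0\<close>, so the weights \<open>k\<close>
    and \<open>1 - k\<close> are chosen to make \<open>F\<close> vanish at \<open>x0\<close>
    too.\<close>
  define F where "F p = (\<Prod>u\<in>C. f u p) - k * (\<Prod>u\<in>B. f u p) - (1 - k) * (\<Prod>u\<in>A. f u p)" for p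
  define P where "P p r = (\<Prod>u\<in>C. [:f u p, f u r:]) - smult k (\<Prod>u\<in>B. [:f u p, f u r:])
    - smult (1 - k) (\<Prod>u\<in>A. [:f u p, f u r:])" for p r
  have FP: "F (\<lambda>i. p i + t * r i) = poly (P p r) t" for p t r
    using lin by (simp add: F_def P_def prod_on_line)
  have F0: "F p = poly (P p r) 0" for p r
    using FP[of p 0 r] by simp
  text \<open>Along the line through \<open>p\<close> in direction \<open>x0\<close> the leading coefficients cancel, so \<open>F\<close> has
    degree less than \<open>card A\<close>, while the points of the line on the hyperplanes of \<open>A\<close> are
    \<open>card A\<close> many zeros.\<close>
  have good: "F p = 0" if dist: "\<And>u u'. u \<in> A \<Longrightarrow> u' \<in> A \<Longrightarrow> u \<noteq> u' \<Longrightarrow> f u p \<noteq> f u' p" for p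
  proof -
    have P: "P p x0 = (\<Prod>u\<in>C. [:f u p, 1:]) - smult k (\<Prod>u\<in>B. [:f u p, 1:])
        - smult (1 - k) (\<Prod>u\<in>A. [:f u p, 1:])"
      using normal by (simp add: P_def)
    note cf = coeff_prod_linear[OF fin(1), of "\<lambda>u. f u p"] coeff_prod_linear[OF fin(2), of "\<lambda>u. f u p"]
      coeff_prod_linear[OF fin(3), of "\<lambda>u. f u p"]
    have deg: "degree (P p x0) \<le> card A"
      unfolding P using cf card
      by (intro degree_diff_le order.trans[OF degree_smult_le]) auto
    have top: "coeff (P p x0) (card A) = 0"
      unfolding P using cf card by simp
    have "P p x0 = 0"
    proof (rule ccontr)
      assume nz: "P p x0 \<noteq> 0"
      then have lt: "degree (P p x0) < card A"
        using deg top by (metis leading_coeff_0_iff nat_less_le)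
      have root: "poly (P p x0) (- f u p) = 0" if u: "u \<in> A" for u
      proof -
        define y where "y = (\<lambda>i. p i + (- f u p) * x0 i)"
        have "f u y = f u p + (- f u p) * f u x0"
          unfolding y_def by (rule linear_formD) (use lin u in auto)
        then have y: "f u y = 0" using normal u by simp
        have "(\<Prod>u\<in>A. f u y) = 0" using y u fin(1) by (auto intro: prod_zero)
        then have "F y = 0" using k[OF u y] by (simp add: F_def)
        then show ?thesis unfolding y_def by (simp only: FP)
      qed
      have "card A = card ((\<lambda>u. - f u p) ` A)"
        by (rule card_image[symmetric]) (use dist in \<open>auto simp: inj_on_def\<close>)
      also have "\<dots> \<le> card {t. poly (P p x0) t = 0}"
        by (rule card_mono) (use nz root poly_roots_finite in auto)
      also have "\<dots> \<le> degree (P p x0)" by (rule card_poly_roots_bound[OF nz])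
      finally show False using lt by simp
    qed
    then show ?thesis using F0[of p x0] by simp
  qed
  \<comment> \<open>A point where two forms of \<open>A\<close> agree is reached along a line in a
    direction \<open>r\<close> that separates the forms of \<open>A\<close>: all but finitely many
    of its points are covered by \<open>good\<close>, so \<open>F\<close> vanishes on the whole
    line.\<close>
  have "F p = 0" for p
  proof -
    let ?I = "{(u, u'). u \<in> A \<and> u' \<in> A \<and> u \<noteq> u'}"
    have finI: "finite ?I" by (rule finite_subset[of _ "A \<times> A"]) (use fin in auto)
    have "\<exists>r\<in>UNIV. \<forall>i\<in>?I. (case i of (u, u') \<Rightarrow> \<lambda>r. f u r - f u' r) r \<noteq> 0"
    proof (rule generic_point[OF finI])
      fix i assume "i \<in> ?I"
      then obtain u u' where i: "i = (u, u')" "u \<in> A" "u' \<in> A" "u \<noteq> u'" by auto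
      show "linear_form (case i of (u, u') \<Rightarrow> \<lambda>r. f u r - f u' r)"
        using i lin by (auto intro!: linear_form_diff)
      obtain p where "f u p = 0" "f u' p \<noteq> 0" using indep2[of u u'] i by auto
      then show "\<exists>p\<in>UNIV. (case i of (u, u') \<Rightarrow> \<lambda>r. f u r - f u' r) p \<noteq> 0"
        using i(1) by (intro bexI[of _ p]) auto
    qed auto
    then obtain r where r: "\<And>u u'. u \<in> A \<Longrightarrow> u' \<in> A \<Longrightarrow> u \<noteq> u' \<Longrightarrow> f u r \<noteq> f u' r" by auto
    let ?Z = "(\<lambda>(u, u'). - (f u p - f u' p) / (f u r - f u' r)) ` ?I"
    have "poly (P p r) t = 0" if t: "t \<notin> ?Z" for t
    proof -
      have "F (\<lambda>i. p i + t * r i) = 0"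
      proof (rule good, rule notI)
        fix u u' assume u: "u \<in> A" "u' \<in> A" "u \<noteq> u'"
        assume "f u (\<lambda>i. p i + t * r i) = f u' (\<lambda>i. p i + t * r i)"
        then have "f u p + t * f u r = f u' p + t * f u' r" using u lin by (simp add: linear_formD)
        then have "t * (f u r - f u' r) = - (f u p - f u' p)" by (simp add: algebra_simps)
        then have "t = - (f u p - f u' p) / (f u r - f u' r)" using r[OF u] by (simp add: field_simps)
        then show False using t u by force
      qed
      then show ?thesis by (simp only: FP)
    qed
    then have "UNIV - ?Z \<subseteq> {t. poly (P p r) t = 0}" by auto
    moreover have "infinite (UNIV - ?Z)"
      by (rule Diff_infinite_finite) (use finI infinite_UNIV_char_0 in auto)
    ultimately have "infinite {t. poly (P p r) t = 0}" using finite_subset by blast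
    then have "P p r = 0" using poly_roots_finite by blast
    then show ?thesis using F0[of p r] by simp
  qed
  then have "\<forall>p. (\<Prod>u\<in>C. f u p) = k * (\<Prod>u\<in>B. f u p) + (1 - k) * (\<Prod>u\<in>A. f u p)"
    by (simp add: F_def algebra_simps)
  then show ?thesis by blast
qed

section \<open>Affine configurations over the field with three elements\<close>

lemma neg_double_exponent3:
  fixes x :: "'g::ab_group_add"
  assumes "x + x + x = 0"
  shows "- x - x = x"
proof -
  have "- x - x = - x - x + (x + x + x)" using assms by simp
  also have "\<dots> = x" by (simp add: algebra_simps)
  finally show ?thesis .
qed

section \<open>Relations between cube roots of unity\<close>

lemma primitive_cube_root_cases:
  fixes v w :: complex
  assumes "w\<^sup>2 + w + 1 = 0" "v\<^sup>2 + v + 1 = 0"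
  shows "v = w \<or> v = w\<^sup>2"
proof -
  have "(v - w) * (v - w\<^sup>2) = (v\<^sup>2 + v + 1) + (w - v - 1) * (w\<^sup>2 + w + 1)"
    by (simp add: algebra_simps power2_eq_square)
  then have "(v - w) * (v - w\<^sup>2) = 0" using assms by simp
  then show ?thesis by simp
qed

text \<open>Hypothesis \<open>e\<close> arises by expanding the vector of \<open>a + b + c\<close> as \<open>(a + b) + c\<close> and as
  \<open>(b + c) + a\<close>, or likewise with \<open>- a\<close> in place of \<open>a\<close>.\<close>

lemma cube_root_ratio:
  fixes A B C :: "'x \<Rightarrow> complex"
  assumes w: "w\<^sup>2 + w + 1 = 0" and v: "v = w \<or> v = w\<^sup>2" and u: "u = w \<or> u = w\<^sup>2"
    and e: "\<And>p. v * (w\<^sup>2 * B p + s * A p) + v\<^sup>2 * C p = u * (w * B p + w\<^sup>2 * C p) + u\<^sup>2 * (t * A p)"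
    and B: "\<nexists>x. \<forall>p. B p = x * A p" and C: "\<nexists>x. \<forall>p. C p = x * A p"
  shows "\<exists>r x. r ^ 3 = 1 \<and> (\<forall>p. B p = r * C p + x * A p)"
proof -
  \<comment> \<open>Equality modulo w^2 + w + 1: \<open>k\<close> is the explicit cofactor, and
    \<open>l\<close> is an expression known to vanish.\<close>
  have ring: "x = y" if "x - y = l - k * (w\<^sup>2 + w + 1)" "l = 0" for x y l k :: complex
    using that w by simp
  have divide: "b = c + d / k * a" if "k * b = k * c + d * a" "k \<noteq> 0" for a b c d k :: complex
  proof -
    have "b = k * b / k" using that(2) by simp
    also have "\<dots> = c + d / k * a" unfolding that(1) using that(2) by (simp add: add_divide_distrib)
    finally show ?thesis .
  qed
  have e: "v * (w\<^sup>2 * B p + s * A p) + v\<^sup>2 * C p - (u * (w * B p + w\<^sup>2 * C p) + u\<^sup>2 * (t * A p)) = 0"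
    (is "?e p = 0") for p using e[of p] by simp
  have nz: "1 - w\<^sup>2 \<noteq> 0" "w - w\<^sup>2 \<noteq> 0" "w - 1 \<noteq> 0"
  proof -
    have "(1 - w\<^sup>2) * (1 - w) = 3"
      by (rule ring[of _ _ 0 "2 - w"]) (simp_all add: algebra_simps power2_eq_square)
    moreover have "(w - w\<^sup>2) * (w - w\<^sup>2) = - 3"
      by (rule ring[of _ _ 0 "- (w\<^sup>2 - 3 * w + 3)"]) (simp_all add: algebra_simps power2_eq_square)
    moreover have "(w - 1) * (w + 2) = - 3"
      by (rule ring[of _ _ 0 "- 1"]) (simp_all add: algebra_simps power2_eq_square)
    ultimately show "1 - w\<^sup>2 \<noteq> 0" "w - w\<^sup>2 \<noteq> 0" "w - 1 \<noteq> 0" by auto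
  qed
  \<comment> \<open>Comparing the coefficients of \<open>B\<close> and \<open>C\<close> on the two
    sides of \<open>e\<close>: for \<open>v = u = w\<close> the ratio is 1, and for v = w^2, u = w
    it is w^2. In the other two cases one of \<open>B\<close>, \<open>C\<close> drops out, which
    makes the remaining one a multiple of \<open>A\<close>.\<close>
  from u v have "(v = w \<and> u = w) \<or> (v = w \<and> u = w\<^sup>2) \<or> (v = w\<^sup>2 \<and> u = w) \<or> (v = w\<^sup>2 \<and> u = w\<^sup>2)"
    by blast
  then show ?thesis
  proof (elim disjE conjE)
    assume vu: "v = w" "u = w"
    have "(1 - w\<^sup>2) * B p = (1 - w\<^sup>2) * (1 * C p) + (w\<^sup>2 * t - w * s) * A p" for p
      by (rule ring[OF _ e[of p], where k = "(w - 1) * (B p - C p)"])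
        (simp add: vu algebra_simps power2_eq_square)
    then have "B p = 1 * C p + (w\<^sup>2 * t - w * s) / (1 - w\<^sup>2) * A p" for p
      by (rule divide[OF _ nz(1)])
    moreover have "(1::complex) ^ 3 = 1" by simp
    ultimately show ?thesis by blast
  next
    assume vu: "v = w" "u = w\<^sup>2"
    have "(w - w\<^sup>2) * C p = (w * s - w * t) * A p" for p
      by (rule ring[of _ _ "- ?e p" "w * (w - 1) * (C p + t * A p)"])
        (use e[of p] in \<open>simp_all add: vu algebra_simps power2_eq_square\<close>)
    then have "C p = (w * s - w * t) / (w - w\<^sup>2) * A p" for p
      using nz(2) by (simp add: eq_divide_imp mult.commute)
    then show ?thesis using C by blast
  next
    assume vu: "v = w\<^sup>2" "u = w"
    have "(w - w\<^sup>2) * B p = (w - w\<^sup>2) * (w\<^sup>2 * C p) + w\<^sup>2 * (t - s) * A p" for p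
      by (rule ring[OF _ e[of p], where k = "w * (w - 1) * B p"])
        (simp add: vu algebra_simps power2_eq_square)
    then have "B p = w\<^sup>2 * C p + w\<^sup>2 * (t - s) / (w - w\<^sup>2) * A p" for p
      by (rule divide[OF _ nz(2)])
    moreover have "(w\<^sup>2) ^ 3 = 1"
      by (rule ring[of _ _ 0 "- (w - 1) * (w ^ 3 + 1)"])
        (simp_all add: algebra_simps power2_eq_square power3_eq_cube)
    ultimately show ?thesis by blast
  next
    assume vu: "v = w\<^sup>2" "u = w\<^sup>2"
    have "(w - 1) * B p = (w * t - w\<^sup>2 * s) * A p" for p
      by (rule ring[OF _ e[of p], where k = "(w - 1) * ((w - 1) * B p - w * t * A p)"])
        (simp add: vu algebra_simps power2_eq_square)
    then have "B p = (w * t - w\<^sup>2 * s) / (w - 1) * A p" for p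
      using nz(3) by (simp add: eq_divide_imp mult.commute)
    then show ?thesis using B by blast
  qed
qed

text \<open>Vectors are functions on an arbitrary type, so linear relations are pointwise
  identities. In exponent 3 the third point of the line through \<open>x\<close> and
  \<open>y\<close> is \<open>- x - y\<close>, and distinct points are collinear exactly if their sum
  is 0.\<close>

locale affine_configuration =
  fixes S :: "'g::ab_group_add set" and q :: "'g \<Rightarrow> 'x \<Rightarrow> complex"
  assumes exponent3: "(x::'g) + x + x = 0"
    and zero_mem: "0 \<in> S"
    and add_mem: "x \<in> S \<Longrightarrow> y \<in> S \<Longrightarrow> x + y \<in> S"
    and uminus_mem: "x \<in> S \<Longrightarrow> - x \<in> S"
    and collinear: "x \<in> S \<Longrightarrow> y \<in> S \<Longrightarrow> x \<noteq> y \<Longrightarrow>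
      \<exists>\<alpha> \<beta>. \<forall>p. q (- x - y) p = \<alpha> * q x p + \<beta> * q y p"
    and independent: "x \<in> S \<Longrightarrow> y \<in> S \<Longrightarrow> z \<in> S \<Longrightarrow> x \<noteq> y \<Longrightarrow> x \<noteq> z \<Longrightarrow> y \<noteq> z \<Longrightarrow>
      x + y + z \<noteq> 0 \<Longrightarrow> (\<And>p. \<alpha> * q x p + \<beta> * q y p + \<gamma> * q z p = 0) \<Longrightarrow>
      \<alpha> = 0 \<and> \<beta> = 0 \<and> \<gamma> = 0"
begin

lemmas neg_double = neg_double_exponent3[OF exponent3]

section \<open>Independent pairs and normalised directions at the origin\<close>

lemma eq_uminus: "x = - x \<longleftrightarrow> x = (0::'g)"
proof
  assume "x = - x"
  then have "x + x = 0" by (subst (asm) eq_neg_iff_add_eq_0)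
  then show "x = 0" using exponent3[of x] by simp
qed simp

text \<open>Linear independence over the field with three elements, where the multiples of
  \<open>x\<close> are 0, \<open>x\<close> and \<open>- x\<close>.\<close>

definition frame :: "'g \<Rightarrow> 'g \<Rightarrow> bool" where
  "frame x y \<longleftrightarrow> x \<in> S \<and> y \<in> S \<and> x \<noteq> 0 \<and> y \<noteq> 0 \<and> x \<noteq> y \<and> x \<noteq> - y"

lemma frameI: "x \<in> S \<Longrightarrow> y \<in> S \<Longrightarrow> x \<noteq> 0 \<Longrightarrow> y \<notin> {0, x, - x} \<Longrightarrow> frame x y"
  by (auto simp: frame_def)

lemma frame_uminus_left: "frame x y \<Longrightarrow> frame (- x) y"
  by (auto simp: frame_def uminus_mem minus_equation_iff)

lemma frame_sym: "frame x y \<Longrightarrow> frame y x"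
  by (auto simp: frame_def)

lemma frame_uminus_right: "frame x y \<Longrightarrow> frame x (- y)"
  using frame_sym frame_uminus_left by blast

lemma frame_add_right: "frame x y \<Longrightarrow> frame x (x + y)"
proof -
  assume f: "frame x y"
  have "x + y \<noteq> 0" using f by (auto simp: frame_def add_eq_0_iff2)
  moreover have "x \<noteq> - (x + y)"
  proof
    assume "x = - (x + y)"
    then have "y = - x - x" by (simp add: algebra_simps eq_neg_iff_add_eq_0)
    then show False using f by (simp add: neg_double frame_def)
  qed
  ultimately show ?thesis using f by (auto simp: frame_def add_mem)
qed

lemma frame_independent:
  assumes "frame x y" "\<And>p. \<alpha> * q 0 p + \<beta> * q x p + \<gamma> * q y p = 0"
  shows "\<alpha> = 0 \<and> \<beta> = 0 \<and> \<gamma> = 0"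
  by (rule independent[of 0 x y]) (use assms zero_mem in \<open>auto simp: frame_def add_eq_0_iff2\<close>)

text \<open>Normalises the points \<open>q a\<close> and \<open>q (- a)\<close> on the line through the origin \<open>q 0\<close> to
  \<open>q 0 + h\<close> and \<open>q 0 - h\<close>; the vector \<open>h\<close> spans the harmonic conjugate of the origin.\<close>

definition is_dir :: "'g \<Rightarrow> ('x \<Rightarrow> complex) \<Rightarrow> bool" where
  "is_dir a h \<longleftrightarrow> (\<exists>s t. s \<noteq> 0 \<and> t \<noteq> 0 \<and> (\<forall>p. q 0 p + h p = s * q a p \<and> q 0 p - h p = t * q (- a) p))"

definition dir :: "'g \<Rightarrow> 'x \<Rightarrow> complex" where
  "dir a = (SOME h. is_dir a h)"

lemma is_dir_dir:
  assumes "frame a b"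
  shows "is_dir a (dir a)"
proof -
  have "a \<in> S" "- a \<in> S" "a \<noteq> - a" using assms by (auto simp: frame_def uminus_mem eq_uminus)
  from collinear[OF this] obtain s t where st: "\<And>p. q 0 p = s * q a p + t * q (- a) p" by auto
  have "s \<noteq> 0"
  proof
    assume "s = 0"
    then have "1 * q 0 p + (- t) * q (- a) p + 0 * q b p = 0" for p using st[of p] by simp
    from frame_independent[OF frame_uminus_left[OF assms] this] show False by simp
  qed
  moreover have "t \<noteq> 0"
  proof
    assume "t = 0"
    then have "1 * q 0 p + (- s) * q a p + 0 * q b p = 0" for p using st[of p] by simp
    from frame_independent[OF assms this] show False by simp
  qed
  \<comment> \<open>As \<open>q 0\<close> is \<open>s * q a + t * q (- a)\<close>, adding this
    vector to \<open>q 0\<close> gives \<open>2 * s * q a\<close> and subtracting it gives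
    \<open>2 * t * q (- a)\<close>.\<close>
  ultimately have "is_dir a (\<lambda>p. 2 * s * q a p - q 0 p)"
    unfolding is_dir_def by (intro exI[of _ "2 * s"] exI[of _ "2 * t"]) (simp add: st algebra_simps)
  then show ?thesis unfolding dir_def by (rule someI[where P = "is_dir a"])
qed

text \<open>The sum of the two defining equations writes \<open>2 * q 0\<close> in terms of the
  independent vectors \<open>q a\<close> and \<open>q (- a)\<close>, so the scalars are
  unique.\<close>

lemma is_dir_unique:
  assumes "frame a b" "is_dir a h" "is_dir a h'"
  shows "h = h'"
proof -
  obtain s t s' t' where e: "\<And>p. q 0 p + h p = s * q a p" "\<And>p. q 0 p - h p = t * q (- a) p"
    "\<And>p. q 0 p + h' p = s' * q a p" "\<And>p. q 0 p - h' p = t' * q (- a) p"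
    using assms(2,3) unfolding is_dir_def by blast
  have "(s - s') * q a p + (t - t') * q (- a) p + 0 * q b p =
      s * q a p + t * q (- a) p - (s' * q a p + t' * q (- a) p)" for p
    by (simp add: algebra_simps)
  then have "(s - s') * q a p + (t - t') * q (- a) p + 0 * q b p = 0" for p
    unfolding e[symmetric] by simp
  moreover have "a \<in> S" "- a \<in> S" "b \<in> S" "a \<noteq> - a" "a \<noteq> b" "- a \<noteq> b" "a + - a + b \<noteq> 0"
    using assms(1) frame_uminus_left[OF assms(1)] by (auto simp: frame_def eq_uminus)
  ultimately have "s - s' = 0 \<and> t - t' = 0 \<and> 0 = (0::complex)"
    by (intro independent)
  then have "s = s'" by simp
  have "h p = h' p" for p
  proof -
    have "q 0 p + h p = q 0 p + h' p" unfolding e(1) e(3) \<open>s = s'\<close> ..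
    then show ?thesis by simp
  qed
  then show ?thesis by auto
qed

text \<open>Exchanging \<open>a\<close> and \<open>- a\<close> exchanges the two normalised points,
  hence changes the sign of their half difference.\<close>

lemma dir_uminus:
  assumes "frame a b"
  shows "dir (- a) p = - dir a p"
proof -
  have "is_dir (- a) (\<lambda>p. - dir a p)"
  proof -
    obtain s t where "s \<noteq> 0" "t \<noteq> 0"
      "\<And>p. q 0 p + dir a p = s * q a p" "\<And>p. q 0 p - dir a p = t * q (- a) p"
      using is_dir_dir[OF assms] unfolding is_dir_def by blast
    then show ?thesis unfolding is_dir_def by (intro exI[of _ t] exI[of _ s]) simp
  qed
  then have "dir (- a) = (\<lambda>p. - dir a p)"
    using is_dir_unique[OF frame_uminus_left[OF assms]] is_dir_dir[OF frame_uminus_left[OF assms]]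
    by blast
  then show ?thesis by simp
qed

lemma dir_independent:
  assumes "frame a b" "\<And>p. x * q 0 p + y * dir a p + z * dir b p = 0"
  shows "x = 0 \<and> y = 0 \<and> z = 0"
proof -
  obtain s t where s: "s \<noteq> 0" "t \<noteq> 0"
    and e: "\<And>p. q 0 p + dir a p = s * q a p" "\<And>p. q 0 p + dir b p = t * q b p"
    using is_dir_dir[OF assms(1)] is_dir_dir[OF frame_sym[OF assms(1)]]
    unfolding is_dir_def by blast
  have "(x - y - z) * q 0 p + (y * s) * q a p + (z * t) * q b p = 0" for p
  proof -
    have "(x - y - z) * q 0 p + (y * s) * q a p + (z * t) * q b p =
      (x - y - z) * q 0 p + y * (s * q a p) + z * (t * q b p)" by simp
    also have "\<dots> = x * q 0 p + y * dir a p + z * dir b p"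
      unfolding e[symmetric] by (simp add: algebra_simps)
    finally show ?thesis using assms(2) by simp
  qed
  from frame_independent[OF assms(1) this] show ?thesis using s by auto
qed

lemma dir_line:
  assumes "frame x y"
  shows "\<exists>\<alpha> \<beta>. \<forall>p. q 0 p + dir (- x - y) p = \<alpha> * (q 0 p + dir x p) + \<beta> * (q 0 p + dir y p)"
proof -
  have "frame (x + y) x" by (rule frame_sym[OF frame_add_right[OF assms]])
  then have fr: "frame (- x - y) x" using frame_uminus_left[of "x + y" x] by (simp add: add.commute)
  obtain r s t where r: "s \<noteq> 0" "t \<noteq> 0"
    and e: "\<And>p. q 0 p + dir (- x - y) p = r * q (- x - y) p"
      "\<And>p. q 0 p + dir x p = s * q x p" "\<And>p. q 0 p + dir y p = t * q y p"
    using is_dir_dir[OF assms] is_dir_dir[OF frame_sym[OF assms]] is_dir_dir[OF fr]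
    unfolding is_dir_def by blast
  have "x \<in> S" "y \<in> S" "x \<noteq> y" using assms by (auto simp: frame_def)
  from collinear[OF this] obtain \<alpha> \<beta> where "\<And>p. q (- x - y) p = \<alpha> * q x p + \<beta> * q y p" by auto
  then have "q 0 p + dir (- x - y) p = (r * \<alpha> / s) * (q 0 p + dir x p) + (r * \<beta> / t) * (q 0 p + dir y p)"
    for p unfolding e using r by (simp add: algebra_simps)
  then show ?thesis by blast
qed

text \<open>The lines through \<open>a\<close>, \<open>b\<close> and through \<open>- a\<close>,
  \<open>- b\<close> have opposite third points. Adding their relations cancels
  \<open>dir (a + b)\<close>; independence then shows that the coefficients agree and sum to
  1.\<close>

lemma dir_add_coefficients:
  assumes "frame a b"
  shows "\<exists>x. \<forall>p. dir (a + b) p = x * dir a p - (1 + x) * dir b p"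
proof -
  have fr: "frame (a + b) a" by (rule frame_sym[OF frame_add_right[OF assms]])
  obtain \<alpha> \<beta> where 1: "\<And>p. q 0 p + dir (- a - b) p = \<alpha> * (q 0 p + dir a p) + \<beta> * (q 0 p + dir b p)"
    using dir_line[OF assms] by blast
  have "- a - b = - (a + b)" by simp
  then have 1: "q 0 p - dir (a + b) p = \<alpha> * (q 0 p + dir a p) + \<beta> * (q 0 p + dir b p)" for p
    using 1[of p] dir_uminus[OF fr, of p] by simp
  obtain \<alpha>' \<beta>' where "\<And>p. q 0 p + dir (- (- a) - (- b)) p =
      \<alpha>' * (q 0 p + dir (- a) p) + \<beta>' * (q 0 p + dir (- b) p)"
    using dir_line[OF frame_uminus_left[OF frame_uminus_right[OF assms]]] by blast
  then have 2: "q 0 p + dir (a + b) p = \<alpha>' * (q 0 p - dir a p) + \<beta>' * (q 0 p - dir b p)" for p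
    using dir_uminus[OF assms] dir_uminus[OF frame_sym[OF assms]] by simp
  have "(\<alpha> + \<alpha>' + \<beta> + \<beta>' - 2) * q 0 p + (\<alpha> - \<alpha>') * dir a p + (\<beta> - \<beta>') * dir b p = 0" for p
  proof -
    have "(\<alpha> + \<alpha>' + \<beta> + \<beta>' - 2) * q 0 p + (\<alpha> - \<alpha>') * dir a p + (\<beta> - \<beta>') * dir b p =
      \<alpha> * (q 0 p + dir a p) + \<beta> * (q 0 p + dir b p) - (q 0 p - dir (a + b) p) +
      (\<alpha>' * (q 0 p - dir a p) + \<beta>' * (q 0 p - dir b p) - (q 0 p + dir (a + b) p))"
      by (simp add: algebra_simps)
    then show ?thesis unfolding 1[symmetric] 2[symmetric] by simp
  qed
  from dir_independent[OF assms this] have e: "\<alpha>' = \<alpha>" "\<beta>' = \<beta>" "2 * (\<alpha> + \<beta> - 1) = 0"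
    by (auto simp: algebra_simps)
  from e(3) have "\<alpha> + \<beta> - 1 = 0" by (simp only: mult_eq_0_iff) simp
  then have e': "\<beta> = 1 - \<alpha>" by (simp add: algebra_simps)
  have "dir (a + b) p = (- \<alpha>) * dir a p - (1 + (- \<alpha>)) * dir b p" for p
    using 1[of p] unfolding e' by (simp add: algebra_simps)
  then show ?thesis by blast
qed

text \<open>The nine points of the plane spanned by \<open>a\<close> and \<open>b\<close> form a Hesse configuration.\<close>

lemma dir_hesse:
  assumes "frame a b"
  shows "\<exists>w. w\<^sup>2 + w + 1 = 0 \<and> (\<forall>p. dir (a + b) p = w * dir a p + w\<^sup>2 * dir b p) \<and>
    (\<forall>p. dir (a - b) p = w\<^sup>2 * dir a p - w * dir b p)"
proof -
  note fs = frame_sym[OF assms]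
  obtain x where x: "\<And>p. dir (a + b) p = x * dir a p - (1 + x) * dir b p"
    using dir_add_coefficients[OF assms] by blast
  obtain y where "\<And>p. dir (a + - b) p = y * dir a p - (1 + y) * dir (- b) p"
    using dir_add_coefficients[OF frame_uminus_right[OF assms]] by blast
  then have y: "dir (a - b) p = y * dir a p + (1 + y) * dir b p" for p
    using dir_uminus[OF fs] by (simp add: algebra_simps)
  \<comment> \<open>Two further lines, \<open>a\<close>, \<open>a + b\<close>, \<open>a - b\<close>
    and \<open>b\<close>, \<open>a + b\<close>, \<open>b - a\<close>, link the coefficients
    \<open>x\<close> of \<open>a + b\<close> and \<open>y\<close> of \<open>a - b\<close>.
    Independence turns them into \<open>x * y = 1\<close> and \<open>y = - (1 + x)\<close>, so
    \<open>x\<close> is a primitive cube root of unity.\<close>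
  obtain \<alpha> \<beta> where "\<And>p. q 0 p + dir (- a - (a + b)) p =
      \<alpha> * (q 0 p + dir a p) + \<beta> * (q 0 p + dir (a + b) p)"
    using dir_line[OF frame_add_right[OF assms]] by blast
  moreover have "- a - (a + b) = a - b" using neg_double[of a] by (simp add: diff_diff_eq[symmetric])
  ultimately have 1: "q 0 p + dir (a - b) p = \<alpha> * (q 0 p + dir a p) + \<beta> * (q 0 p + dir (a + b) p)" for p
    by simp
  obtain \<gamma> \<delta> where "\<And>p. q 0 p + dir (- b - (b + a)) p =
      \<gamma> * (q 0 p + dir b p) + \<delta> * (q 0 p + dir (b + a) p)"
    using dir_line[OF frame_add_right[OF fs]] by blast
  moreover have "- b - (b + a) = - (a - b)" using neg_double[of b] by (simp add: diff_diff_eq[symmetric])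
  moreover have "frame (a - b) a"
    using frame_sym[OF frame_add_right[OF frame_uminus_right[OF assms]]] by simp
  ultimately have 2: "q 0 p - dir (a - b) p = \<gamma> * (q 0 p + dir b p) + \<delta> * (q 0 p + dir (a + b) p)" for p
    using dir_uminus[of "a - b" a p] by (metis add.commute diff_conv_add_uminus)
  have "(1 - \<alpha> - \<beta>) * q 0 p + (y - \<alpha> - \<beta> * x) * dir a p + (1 + y + \<beta> * (1 + x)) * dir b p = 0" for p
    using 1[of p, unfolded x y] by (simp add: algebra_simps)
  from dir_independent[OF assms this] have e1: "1 - \<alpha> - \<beta> = 0" "y - \<alpha> - \<beta> * x = 0" "1 + y + \<beta> * (1 + x) = 0"
    by auto
  have "(1 - \<gamma> - \<delta>) * q 0 p + (- y - \<delta> * x) * dir a p + (- (1 + y) - \<gamma> + \<delta> * (1 + x)) * dir b p = 0" for p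
    using 2[of p, unfolded x y] by (simp add: algebra_simps)
  from dir_independent[OF assms this] have e2: "1 - \<gamma> - \<delta> = 0" "- y - \<delta> * x = 0" "- (1 + y) - \<gamma> + \<delta> * (1 + x) = 0"
    by blast+
  have \<alpha>: "\<alpha> = 1 - \<beta>" using e1(1) by (simp add: algebra_simps)
  have yx: "y = 1 - \<beta> + \<beta> * x" using e1(2) unfolding \<alpha> by (simp add: algebra_simps)
  have "1 + (1 - \<beta> + \<beta> * x) + \<beta> * (1 + x) = 0" using e1(3) unfolding yx .
  then have "2 * (\<beta> * x + 1) = 0" by (simp add: algebra_simps)
  then have "\<beta> * x + 1 = 0" by (simp only: mult_eq_0_iff) simp
  then have \<beta>: "\<beta> * x = - 1" "y = - \<beta>" using yx by (auto simp: add_eq_0_iff2)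
  then have xy: "x * y = 1" by (simp add: mult.commute)
  have \<gamma>: "\<gamma> = 1 - \<delta>" using e2(1) by (simp add: algebra_simps)
  have \<delta>x: "\<delta> * x = - y" using e2(2) by (simp add: algebra_simps)
  then have \<delta>1x: "\<delta> * (1 + x) = \<delta> - y" by (simp add: algebra_simps)
  have "- (1 + y) - (1 - \<delta>) + (\<delta> - y) = 0" using e2(3) unfolding \<gamma> \<delta>1x .
  then have "2 * (1 + y - \<delta>) = 0" by (simp add: algebra_simps)
  then have "1 + y = \<delta>" by (simp only: mult_eq_0_iff) simp
  then have "y = - (1 + y) * x" using \<delta>x by simp
  then have "y = - x - x * y" by (simp add: algebra_simps)
  then have y': "y = - (1 + x)" unfolding xy by simp
  then have "x * (- (1 + x)) = 1" using xy by simp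
  then have "- (x\<^sup>2 + x + 1) = 0" by (simp add: algebra_simps power2_eq_square)
  then have w: "x\<^sup>2 + x + 1 = 0" by (simp only: neg_equal_0_iff_equal)
  have "x\<^sup>2 = (x\<^sup>2 + x + 1) - (1 + x)" by simp
  then have x2: "- (1 + x) = x\<^sup>2" unfolding w by simp
  have y2: "y = x\<^sup>2" unfolding y' by (rule x2)
  have y1: "1 + y = - x" unfolding y' by simp
  have "dir (a + b) p = x * dir a p + x\<^sup>2 * dir b p" for p
    unfolding x2[symmetric] using x[of p] by (simp add: algebra_simps)
  moreover have "dir (a - b) p = x\<^sup>2 * dir a p - x * dir b p" for p
    using y[of p] unfolding y1 unfolding y2 by simp
  ultimately show ?thesis using w by blast
qed

text \<open>Measures the root belonging to any plane against one fixed root \<open>w\<close>, so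
  that different planes can be compared.\<close>

lemma dir_hesse_add:
  assumes "frame a b" "w\<^sup>2 + w + 1 = 0"
  shows "\<exists>v. (v = w \<or> v = w\<^sup>2) \<and> (\<forall>p. dir (a + b) p = v * dir a p + v\<^sup>2 * dir b p)"
  using dir_hesse[OF assms(1)] primitive_cube_root_cases[OF assms(2)] by blast

text \<open>For \<open>c\<close> outside the plane of \<open>a\<close> and \<open>b\<close>,
  expanding a sum of three points in two ways makes \<open>dir a\<close>, \<open>dir b\<close>,
  \<open>dir c\<close> dependent, with a cube root of unity as the ratio modulo
  \<open>dir a\<close>.\<close>

lemma dir_ratio:
  assumes "frame a b" and c: "c \<in> S"
    "c \<notin> {0, a, - a, b, - b, a + b, - a - b, a - b, b - a}"
  shows "\<exists>r x. r ^ 3 = 1 \<and> (\<forall>p. dir b p = r * dir c p + x * dir a p)"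
proof -
  have ab: "a \<in> S" "b \<in> S" "a \<noteq> 0" "b \<noteq> 0" "a \<noteq> b" "a \<noteq> - b"
    using assms(1) by (auto simp: frame_def)
  have mem: "a + b \<in> S" "b - a \<in> S" "b + c \<in> S"
    using add_mem[of a b] add_mem[of b "- a"] add_mem[of b c] uminus_mem[of a] ab c by auto
  have "a + b \<noteq> 0" "b - a \<noteq> 0" using ab by (auto simp: add_eq_0_iff2)
  moreover have "- (a + b) = - a - b" "- (b - a) = a - b" by simp_all
  moreover have "b + c \<notin> {0, a, - a}"
  proof
    assume "b + c \<in> {0, a, - a}"
    then have "c = 0 - b \<or> c = a - b \<or> c = - a - b" by (auto simp: eq_diff_eq add.commute add_eq_0_iff)
    then show False using c by auto
  qed
  ultimately have fr: "frame b c" "frame a c" "frame (a + b) c" "frame (b - a) c" "frame a (b + c)"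
    using ab c mem by (auto intro!: frameI)
  note fr = fr(1-4) frame_sym[OF fr(5)]
  obtain w where w: "w\<^sup>2 + w + 1 = 0" and bc: "\<And>p. dir (b + c) p = w * dir b p + w\<^sup>2 * dir c p"
    using dir_hesse[OF fr(1)] by blast
  obtain g where g: "g\<^sup>2 + g + 1 = 0" and gab: "\<And>p. dir (a + b) p = g * dir a p + g\<^sup>2 * dir b p"
    and amb: "\<And>p. dir (a - b) p = g\<^sup>2 * dir a p - g * dir b p"
    using dir_hesse[OF assms(1)] by blast
  have "frame (a - b) a"
    using frame_sym[OF frame_add_right[OF frame_uminus_right[OF assms(1)]]] by simp
  from dir_uminus[OF this] have bma: "dir (b - a) p = g * dir b p - g\<^sup>2 * dir a p" for p
    by (simp add: amb)
  have B: "\<nexists>x. \<forall>p. dir b p = x * dir a p"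
  proof
    assume "\<exists>x. \<forall>p. dir b p = x * dir a p"
    then obtain x where "\<And>p. dir b p = x * dir a p" by blast
    then have "0 * q 0 p + (- x) * dir a p + 1 * dir b p = 0" for p by simp
    from dir_independent[OF assms(1) this] show False by simp
  qed
  have C: "\<nexists>x. \<forall>p. dir c p = x * dir a p"
  proof
    assume "\<exists>x. \<forall>p. dir c p = x * dir a p"
    then obtain x where "\<And>p. dir c p = x * dir a p" by blast
    then have "0 * q 0 p + (- x) * dir a p + 1 * dir c p = 0" for p by simp
    from dir_independent[OF fr(2) this] show False by simp
  qed
  \<comment> \<open>The root \<open>w\<close> belongs to the plane of \<open>b\<close>,
    \<open>c\<close> and \<open>g\<close> to that of \<open>a\<close>, \<open>b\<close>. If they
    differ, \<open>a\<close> is replaced by \<open>- a\<close>; either way \<open>dir b\<close>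
    enters the first expansion with coefficient w^2, as \<open>cube_root_ratio\<close>
    requires.\<close>
  from primitive_cube_root_cases[OF w g] show ?thesis
  proof
    assume gw: "g = w"
    obtain v where v: "v = w \<or> v = w\<^sup>2" "\<And>p. dir (a + b + c) p = v * dir (a + b) p + v\<^sup>2 * dir c p"
      using dir_hesse_add[OF fr(3) w] by blast
    obtain u where u: "u = w \<or> u = w\<^sup>2" "\<And>p. dir (b + c + a) p = u * dir (b + c) p + u\<^sup>2 * dir a p"
      using dir_hesse_add[OF fr(5) w] by blast
    have "b + c + a = a + b + c" by (simp add: add_ac)
    note u' = u(2)[unfolded this]
    have "dir (a + b) p = w\<^sup>2 * dir b p + w * dir a p" for p by (simp add: gab gw)
    then have "v * (w\<^sup>2 * dir b p + w * dir a p) + v\<^sup>2 * dir c p =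
        u * (w * dir b p + w\<^sup>2 * dir c p) + u\<^sup>2 * (1 * dir a p)" for p
      using v(2)[of p] u'[of p] by (simp add: bc)
    from cube_root_ratio[OF w v(1) u(1) this B C] show ?thesis .
  next
    assume gw: "g = w\<^sup>2"
    have "(w\<^sup>2)\<^sup>2 = w + (w * (w - 1)) * (w\<^sup>2 + w + 1)" by (simp add: algebra_simps power2_eq_square)
    then have w4: "(w\<^sup>2)\<^sup>2 = w" using w by simp
    obtain v where v: "v = w \<or> v = w\<^sup>2" "\<And>p. dir (b - a + c) p = v * dir (b - a) p + v\<^sup>2 * dir c p"
      using dir_hesse_add[OF fr(4) w] by blast
    obtain u where u: "u = w \<or> u = w\<^sup>2"
      "\<And>p. dir (b + c + - a) p = u * dir (b + c) p + u\<^sup>2 * dir (- a) p"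
      using dir_hesse_add[OF frame_uminus_right[OF fr(5)] w] by blast
    have "b + c + - a = b - a + c" by (simp add: algebra_simps)
    note u' = u(2)[unfolded this]
    have "dir (b - a) p = w\<^sup>2 * dir b p + (- w) * dir a p" for p
      unfolding bma gw w4 by simp
    then have "v * (w\<^sup>2 * dir b p + (- w) * dir a p) + v\<^sup>2 * dir c p =
        u * (w * dir b p + w\<^sup>2 * dir c p) + u\<^sup>2 * (- 1 * dir a p)" for p
      using v(2)[of p] u'[of p] dir_uminus[OF assms(1), of p] by (simp add: bc)
    from cube_root_ratio[OF w v(1) u(1) this B C] show ?thesis .
  qed
qed

text \<open>The excluded set is symmetric, so \<open>dir_ratio\<close> applies to \<open>c\<close>
  and to \<open>- c\<close>. As \<open>dir (- c)\<close> is \<open>- dir c\<close>, the two ratios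
  are negatives of each other, yet both have cube 1.\<close>

theorem no_spatial_configuration:
  assumes "frame a b" and c: "c \<in> S"
    "c \<notin> {0, a, - a, b, - b, a + b, - a - b, a - b, b - a}"
  shows False
proof -
  have "- c \<in> S" "- c \<notin> {0, a, - a, b, - b, a + b, - a - b, a - b, b - a}"
    using c by (auto simp: uminus_mem minus_equation_iff[of c])
  from dir_ratio[OF assms(1) this] obtain r' x' where
    r': "r' ^ 3 = 1" "\<And>p. dir b p = r' * dir (- c) p + x' * dir a p" by blast
  obtain r x where r: "r ^ 3 = 1" "\<And>p. dir b p = r * dir c p + x * dir a p"
    using dir_ratio[OF assms] by blast
  have fr: "frame c a" using assms by (auto simp: frame_def)
  have "0 * q 0 p + (r + r') * dir c p + (x - x') * dir a p = 0" for p
    using r(2)[of p] r'(2)[of p] dir_uminus[OF fr, of p] by (simp add: algebra_simps)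
  from dir_independent[OF fr this] have "r = - r'" by (simp add: add_eq_0_iff2)
  then have "r ^ 3 = - (r' ^ 3)" by simp
  then show False using r(1) r'(1) by simp
qed

end

section \<open>Labelled arrangements\<close>

text \<open>What is used of a realized matroid with its labels: \<open>line\<close> says that the
  hyperplanes through the intersection of two differently labelled ones are these two and a single
  third one, with the collinear label. The point \<open>x0\<close> lies on no hyperplane.\<close>

locale labelled_arrangement =
  fixes E :: "'a set" and f :: "'a \<Rightarrow> (nat \<Rightarrow> complex) \<Rightarrow> complex"
    and L :: "'a \<Rightarrow> 'g::ab_group_add" and x0 :: "nat \<Rightarrow> complex"
  assumes finite_E: "finite E"
    and exponent3: "(x::'g) + x + x = 0"
    and lin: "u \<in> E \<Longrightarrow> linear_form (f u)"
    and normal: "u \<in> E \<Longrightarrow> f u x0 = 1"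
    and indep2: "u \<in> E \<Longrightarrow> v \<in> E \<Longrightarrow> u \<noteq> v \<Longrightarrow> \<exists>p. f u p = 0 \<and> f v p \<noteq> 0"
    and origin: "\<exists>u\<in>E. L u = 0"
    and line: "u \<in> E \<Longrightarrow> v \<in> E \<Longrightarrow> L u \<noteq> L v \<Longrightarrow> \<exists>w\<in>E. L w = - L u - L v \<and>
      (\<forall>z\<in>E. (\<forall>p. f u p = 0 \<longrightarrow> f v p = 0 \<longrightarrow> f z p = 0) \<longleftrightarrow> z \<in> {u, v, w})"
begin

text \<open>Collinearity in the dual projective space, where hyperplanes are points.\<close>

definition on_line :: "'a \<Rightarrow> 'a \<Rightarrow> 'a \<Rightarrow> bool" where
  "on_line u v z \<longleftrightarrow> (\<forall>p. f u p = 0 \<longrightarrow> f v p = 0 \<longrightarrow> f z p = 0)"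

definition fibre :: "'g \<Rightarrow> 'a set" where
  "fibre x = {u \<in> E. L u = x}"

definition fibre_form :: "'g \<Rightarrow> (nat \<Rightarrow> complex) \<Rightarrow> complex" where
  "fibre_form x p = (\<Prod>u\<in>fibre x. f u p)"

lemmas neg_double = neg_double_exponent3[OF exponent3]

section \<open>Lines of the arrangement and fibres of the labelling\<close>

lemma third_neq:
  fixes x y :: 'g
  assumes "x \<noteq> y"
  shows "- x - y \<noteq> x" "- x - y \<noteq> y"
proof -
  show "- x - y \<noteq> x"
  proof
    assume "- x - y = x"
    then have "y = - x - x" by (simp add: algebra_simps)
    then show False using assms by (simp add: neg_double)
  qed
  show "- x - y \<noteq> y"
  proof
    assume "- x - y = y"
    then have "- x - y = - y - y" by (simp add: neg_double)
    then show False using assms by simp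
  qed
qed

text \<open>\<open>f w\<close> is a combination of \<open>f v\<close> and \<open>f u\<close>; the
  coefficient of \<open>f v\<close> is nonzero because \<open>f w\<close> does not vanish on the
  whole kernel of \<open>f u\<close>.\<close>

lemma on_line_exchange:
  assumes "u \<in> E" "v \<in> E" "w \<in> E" "u \<noteq> v" "u \<noteq> w" "on_line u v w"
  shows "on_line u w v"
proof -
  have "\<exists>c d. \<forall>p. f w p = c * f v p + d * f u p"
    by (rule form_in_span) (use assms lin indep2 in \<open>auto simp: on_line_def\<close>)
  then obtain c d where cd: "\<And>p. f w p = c * f v p + d * f u p" by blast
  obtain p where "f u p = 0" "f w p \<noteq> 0" using indep2 assms by blast
  then have "c \<noteq> 0" using cd[of p] by auto
  then show ?thesis using cd unfolding on_line_def by auto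
qed

lemma on_line_third:
  assumes "u \<in> fibre x" "v \<in> fibre y" "x \<noteq> y"
  shows "\<exists>w\<in>fibre (- x - y). \<forall>z\<in>E. on_line u v z \<longleftrightarrow> z \<in> {u, v, w}"
proof -
  have uv: "u \<in> E" "v \<in> E" "L u = x" "L v = y" using assms by (auto simp: fibre_def)
  then have "L u \<noteq> L v" using assms by simp
  from line[OF uv(1,2) this] obtain w where "w \<in> E" "L w = - L u - L v"
    "\<forall>z\<in>E. (\<forall>p. f u p = 0 \<longrightarrow> f v p = 0 \<longrightarrow> f z p = 0) \<longleftrightarrow> z \<in> {u, v, w}" by blast
  then show ?thesis using uv unfolding on_line_def fibre_def by blast
qed

lemma on_line_fibre:
  assumes "u \<in> fibre x" "v \<in> fibre y" "x \<noteq> y" "z \<in> E" "on_line u v z"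
  shows "z = u \<or> z = v \<or> L z = - x - y"
  using on_line_third[OF assms(1-3)] assms(4,5) by (auto simp: fibre_def)

lemma finite_fibre: "finite (fibre x)"
  using finite_E by (auto simp: fibre_def)

lemma fibre_nonempty: "x \<in> L ` E \<Longrightarrow> fibre x \<noteq> {}"
  by (auto simp: fibre_def)

text \<open>The third point of the line through \<open>u\<close> and \<open>v\<close> determines
  \<open>v\<close>: the line through \<open>u\<close> and \<open>\<sigma> v\<close> contains only
  one point with label \<open>y\<close>.\<close>

lemma third_injection:
  assumes u: "u \<in> fibre x" and xy: "x \<noteq> y"
  shows "\<exists>\<sigma>. inj_on \<sigma> (fibre y) \<and> \<sigma> ` fibre y \<subseteq> fibre (- x - y) \<and> (\<forall>v\<in>fibre y. on_line u v (\<sigma> v))"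
proof -
  have "\<forall>v\<in>fibre y. \<exists>w\<in>fibre (- x - y). on_line u v w"
  proof
    fix v assume "v \<in> fibre y"
    from on_line_third[OF u this xy] obtain w where
      "w \<in> fibre (- x - y)" "\<forall>z\<in>E. on_line u v z \<longleftrightarrow> z \<in> {u, v, w}" by blast
    moreover from this have "w \<in> E" by (simp add: fibre_def)
    ultimately show "\<exists>w\<in>fibre (- x - y). on_line u v w" by blast
  qed
  then obtain \<sigma> where \<sigma>: "\<And>v. v \<in> fibre y \<Longrightarrow> \<sigma> v \<in> fibre (- x - y)" "\<And>v. v \<in> fibre y \<Longrightarrow> on_line u v (\<sigma> v)"
    by metis
  note ne = third_neq[OF xy]
  have "v = v'" if v: "v \<in> fibre y" "v' \<in> fibre y" and eq: "\<sigma> v = \<sigma> v'" for v v'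
  proof -
    have ol: "on_line u (\<sigma> v) z" if "z \<in> fibre y" "\<sigma> z = \<sigma> v" for z
    proof -
      have "u \<noteq> z" "u \<noteq> \<sigma> z" "u \<in> E" "z \<in> E" "\<sigma> z \<in> E"
        using that(1) \<sigma>(1)[OF that(1)] u xy ne by (auto simp: fibre_def)
      from on_line_exchange[OF this(3,4,5,1,2) \<sigma>(2)[OF that(1)]] show ?thesis unfolding that(2) .
    qed
    obtain w where w: "\<forall>z\<in>E. on_line u (\<sigma> v) z \<longleftrightarrow> z \<in> {u, \<sigma> v, w}"
      using on_line_third[OF u \<sigma>(1)[OF v(1)]] ne by metis
    have "v \<in> {u, \<sigma> v, w}" "v' \<in> {u, \<sigma> v, w}"
      using w ol[OF v(1)] ol[OF v(2)] eq v by (auto simp: fibre_def)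
    moreover have "u \<notin> fibre y" "\<sigma> v \<notin> fibre y" using u \<sigma>(1)[OF v(1)] xy ne by (auto simp: fibre_def)
    ultimately show ?thesis using v by auto
  qed
  then have "inj_on \<sigma> (fibre y)" by (auto simp: inj_on_def)
  then show ?thesis using \<sigma> by blast
qed

lemma third_mem: "x \<in> L ` E \<Longrightarrow> y \<in> L ` E \<Longrightarrow> - x - y \<in> L ` E"
proof (cases "x = y")
  case False
  assume "x \<in> L ` E" "y \<in> L ` E"
  then obtain u v where "u \<in> fibre x" "v \<in> fibre y" by (auto simp: fibre_def)
  from on_line_third[OF this False] obtain w where "w \<in> E" "L w = - x - y"
    by (auto simp: fibre_def)
  then show ?thesis by force
qed (simp add: neg_double)

lemma card_fibre_le:
  assumes "x \<in> L ` E" "x \<noteq> y"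
  shows "card (fibre y) \<le> card (fibre (- x - y))"
proof -
  obtain u where "u \<in> fibre x" using fibre_nonempty[OF assms(1)] by auto
  from third_injection[OF this assms(2)] show ?thesis
    using card_inj_on_le finite_fibre by metis
qed

text \<open>For fixed \<open>x\<close> the third label is an involution, so the inequality holds in
  both directions.\<close>

lemma card_fibre_third:
  assumes "x \<in> L ` E" "x \<noteq> y"
  shows "card (fibre (- x - y)) = card (fibre y)"
proof (rule antisym)
  have "x \<noteq> - x - y" using third_neq[OF assms(2)] by auto
  from card_fibre_le[OF assms(1) this] show "card (fibre (- x - y)) \<le> card (fibre y)" by simp
qed (rule card_fibre_le[OF assms])

lemma fibre_form_collinear:
  assumes x: "x \<in> L ` E" and y: "y \<in> L ` E" and xy: "x \<noteq> y"
  shows "\<exists>\<alpha> \<beta>. \<forall>p. fibre_form (- x - y) p = \<alpha> * fibre_form x p + \<beta> * fibre_form y p"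
proof -
  note ne = third_neq[OF xy]
  have sub: "fibre x \<union> fibre y \<union> fibre (- x - y) \<subseteq> E" by (auto simp: fibre_def)
  have "\<exists>c. \<forall>p. (\<Prod>u\<in>fibre (- x - y). f u p) =
    c * (\<Prod>u\<in>fibre y. f u p) + (1 - c) * (\<Prod>u\<in>fibre x. f u p)"
  proof (rule pencil_relation)
    show "card (fibre y) = card (fibre (- x - y))" using card_fibre_third[OF x xy] by simp
    have "- y - x = - x - y" by (simp add: algebra_simps)
    then show "card (fibre x) = card (fibre y)"
      using card_fibre_third[OF x xy] card_fibre_third[OF y xy[symmetric]] by metis
    show "fibre x \<noteq> {}" by (rule fibre_nonempty[OF x])
    show "fibre x \<inter> fibre y = {}" "fibre x \<inter> fibre (- x - y) = {}"
      using xy ne by (auto simp: fibre_def)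
    show "\<exists>\<sigma>. bij_betw \<sigma> (fibre y) (fibre (- x - y)) \<and>
      (\<forall>v\<in>fibre y. \<forall>p. f u p = 0 \<longrightarrow> f v p = 0 \<longrightarrow> f (\<sigma> v) p = 0)" if u: "u \<in> fibre x" for u
    proof -
      from third_injection[OF u xy] obtain \<sigma> where \<sigma>: "inj_on \<sigma> (fibre y)"
        "\<sigma> ` fibre y \<subseteq> fibre (- x - y)" "\<forall>v\<in>fibre y. on_line u v (\<sigma> v)" by blast
      have "\<sigma> ` fibre y = fibre (- x - y)"
        by (rule card_subset_eq[OF finite_fibre \<sigma>(2)])
          (simp add: card_image[OF \<sigma>(1)] card_fibre_third[OF x xy])
      then show ?thesis using \<sigma>(1,3) unfolding bij_betw_def on_line_def by blast
    qed
    \<comment> \<open>Otherwise \<open>u'\<close> would lie on the line through \<open>u\<close> and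
      \<open>v\<close>, on which \<open>u\<close> is the only point with label
      \<open>x\<close>.\<close>
    show "\<exists>p. f u p = 0 \<and> f u' p = 0 \<and> f v p \<noteq> 0"
      if u: "u \<in> fibre x" "u' \<in> fibre x" "u \<noteq> u'" and v: "v \<in> fibre y" for u u' v
    proof (rule ccontr)
      assume "\<not> ?thesis"
      then have "on_line u u' v" by (auto simp: on_line_def)
      then have "on_line u v u'"
        by (rule on_line_exchange[rotated -1]) (use u v xy in \<open>auto simp: fibre_def\<close>)
      then have "u' = u \<or> u' = v \<or> L u' = - x - y"
        by (rule on_line_fibre[OF u(1) v xy, rotated]) (use u in \<open>auto simp: fibre_def\<close>)
      then show False using u v xy ne by (auto simp: fibre_def)
    qed
    show "linear_form (f u)" "f u x0 = 1" if "u \<in> fibre x \<union> fibre y \<union> fibre (- x - y)" for u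
      using lin normal subsetD[OF sub that] by auto
    show "\<exists>p. f u p = 0 \<and> f v p \<noteq> 0"
      if "u \<in> fibre x \<union> fibre y \<union> fibre (- x - y)" "v \<in> fibre x \<union> fibre y \<union> fibre (- x - y)" "u \<noteq> v"
      for u v
      using indep2 that subsetD[OF sub] by blast
  qed (fact finite_fibre)+
  then obtain c where "\<And>p. fibre_form (- x - y) p = c * fibre_form y p + (1 - c) * fibre_form x p"
    unfolding fibre_form_def by blast
  then have "\<forall>p. fibre_form (- x - y) p = (1 - c) * fibre_form x p + c * fibre_form y p"
    by simp
  then show ?thesis by blast
qed

text \<open>Take one hyperplane from each of the first two fibres. Their line carries only the
  labels \<open>x\<close>, \<open>y\<close>, \<open>- x - y\<close>, so no form of the fibre of
  \<open>z\<close> vanishes on their intersection, and a generic point there works.\<close>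

lemma fibre_form_separated:
  assumes "x \<in> L ` E" "y \<in> L ` E" and xyz: "x \<noteq> y" "x \<noteq> z" "y \<noteq> z" "x + y + z \<noteq> 0"
  shows "\<exists>p. fibre_form x p = 0 \<and> fibre_form y p = 0 \<and> fibre_form z p \<noteq> 0"
proof -
  obtain u v where u: "u \<in> fibre x" and v: "v \<in> fibre y"
    using assms(1,2)[THEN fibre_nonempty] by auto
  have l: "linear_form (f u)" "linear_form (f v)" using lin u v by (auto simp: fibre_def)
  have zz: "f u (\<lambda>i. 0) = 0" "f v (\<lambda>i. 0) = 0"
    using l[THEN linear_formD, of "\<lambda>i. 0" 1 "\<lambda>i. 0"] by auto
  have "\<exists>p\<in>{p. f u p = 0 \<and> f v p = 0}. \<forall>w\<in>fibre z. f w p \<noteq> 0"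
  proof (rule generic_point[OF finite_fibre])
    show "{p. f u p = 0 \<and> f v p = 0} \<noteq> {}" using zz by blast
    fix w assume w: "w \<in> fibre z"
    then show "linear_form (f w)" using lin by (simp add: fibre_def)
    have "z \<noteq> - x - y"
    proof
      assume "z = - x - y"
      then have "x + y + z = 0" by simp
      then show False using xyz by simp
    qed
    then have "\<not> on_line u v w"
      using on_line_fibre[OF u v xyz(1), of w] w u v xyz by (auto simp: fibre_def)
    then show "\<exists>p\<in>{p. f u p = 0 \<and> f v p = 0}. f w p \<noteq> 0" by (auto simp: on_line_def)
  qed (use l in \<open>auto simp: linear_formD\<close>)
  then obtain p where p: "f u p = 0" "f v p = 0" "\<forall>w\<in>fibre z. f w p \<noteq> 0" by auto
  have "fibre_form x p = 0" "fibre_form y p = 0" "fibre_form z p \<noteq> 0"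
    using u v p finite_fibre by (auto simp: fibre_form_def)
  then show ?thesis by blast
qed

sublocale affine_configuration "L ` E" fibre_form
proof
  show "0 \<in> L ` E" using origin by force
  \<comment> \<open>The third point on the line through \<open>x\<close> and the origin is
    \<open>- x\<close>; sums arise as third points of negatives.\<close>
  then show neg: "- x \<in> L ` E" if "x \<in> L ` E" for x using third_mem[OF that] by force
  show "x + y \<in> L ` E" if "x \<in> L ` E" "y \<in> L ` E" for x y
    using third_mem[OF neg[OF that(1)] neg[OF that(2)]] by simp
  fix x y z :: 'g and \<alpha> \<beta> \<gamma>
  assume xyz: "x \<in> L ` E" "y \<in> L ` E" "z \<in> L ` E" "x \<noteq> y" "x \<noteq> z" "y \<noteq> z" "x + y + z \<noteq> 0"
    and e: "\<And>p. \<alpha> * fibre_form x p + \<beta> * fibre_form y p + \<gamma> * fibre_form z p = 0"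
  have s: "x + z + y \<noteq> 0" "y + z + x \<noteq> 0" using xyz(7) by (simp_all add: add_ac)
  obtain p where "fibre_form x p = 0" "fibre_form y p = 0" "fibre_form z p \<noteq> 0"
    using fibre_form_separated[of x y z] xyz by blast
  then have "\<gamma> = 0" using e[of p] by simp
  moreover obtain p where "fibre_form x p = 0" "fibre_form z p = 0" "fibre_form y p \<noteq> 0"
    using fibre_form_separated[of x z y] xyz s by blast
  then have "\<beta> = 0" using e[of p] by simp
  moreover obtain p where "fibre_form y p = 0" "fibre_form z p = 0" "fibre_form x p \<noteq> 0"
    using fibre_form_separated[of y z x] xyz s by blast
  then have "\<alpha> = 0" using e[of p] by simp
  ultimately show "\<alpha> = 0 \<and> \<beta> = 0 \<and> \<gamma> = 0" by blast
qed (use exponent3 fibre_form_collinear in auto)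

end


section \<open>Realizations\<close>

context matroid
begin

lemma finite_subsets: "finite {T. T \<subseteq> S \<and> indep M T}"
  by (rule finite_subset[of _ "Pow (ground M)"]) (use indep_subset_ground finite_ground in auto)

lemma finite_indep: "indep M T \<Longrightarrow> finite T"
  using indep_subset_ground finite_ground finite_subset by blast

lemma mrank_attained: "\<exists>T\<subseteq>S. indep M T \<and> card T = mrank M S"
proof -
  have "mrank M S \<in> card ` {T. T \<subseteq> S \<and> indep M T}"
    unfolding mrank_def by (rule Max_in) (use finite_subsets indep_empty in auto)
  then show ?thesis by auto
qed

lemma extend_to_basis:
  assumes "indep M S" "S \<subseteq> F"
  shows "\<exists>B. S \<subseteq> B \<and> B \<subseteq> F \<and> indep M B \<and> card B = mrank M F"
proof -
  let ?P = "\<lambda>B. S \<subseteq> B \<and> B \<subseteq> F \<and> indep M B"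
  have "\<exists>B. ?P B \<and> (\<forall>C. ?P C \<longrightarrow> card C \<le> card B)"
    by (rule ex_has_greatest_nat[of ?P S card "Suc (mrank M F)"])
      (use assms mrank_ge in \<open>auto simp: less_Suc_eq_le\<close>)
  then obtain B where B: "?P B" "\<And>C. ?P C \<Longrightarrow> card C \<le> card B" by blast
  obtain T where T: "T \<subseteq> F" "indep M T" "card T = mrank M F" using mrank_attained by blast
  have "\<not> card B < card T"
  proof
    assume "card B < card T"
    then obtain x where x: "x \<in> T - B" "indep M (insert x B)" using augment B(1) T(2) by blast
    have "S \<subseteq> insert x B \<and> insert x B \<subseteq> F \<and> indep M (insert x B)" using x B(1) T(1) by auto
    from B(2)[OF this] have "card (insert x B) \<le> card B" .
    then show False using x finite_indep B(1) by simp
  qed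
  moreover have "card B \<le> mrank M F" using mrank_ge B(1) by blast
  ultimately show ?thesis using B(1) T(3) by auto
qed

text \<open>Extend a basis \<open>I\<close> of \<open>S\<close> to a basis \<open>B\<close> of
  \<open>F\<close>. If \<open>x\<close> raised the rank of \<open>F\<close>, augmentation would make
  \<open>insert x B\<close>, hence \<open>insert x I\<close>, independent, although \<open>x\<close>
  is in the span of \<open>S\<close>.\<close>

lemma mspan_mono:
  assumes "S \<subseteq> F"
  shows "mspan M S \<subseteq> mspan M F"
proof
  fix x assume x: "x \<in> mspan M S"
  have "mrank M (insert x F) = mrank M F"
  proof (rule antisym)
    show "mrank M F \<le> mrank M (insert x F)"
      using mrank_attained[of F] mrank_ge[of _ "insert x F"] by (metis subset_insertI2)
    show "mrank M (insert x F) \<le> mrank M F"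
    proof (rule ccontr)
      assume less: "\<not> ?thesis"
      obtain I where I: "I \<subseteq> S" "indep M I" "card I = mrank M S" using mrank_attained by blast
      then obtain B where B: "I \<subseteq> B" "B \<subseteq> F" "indep M B" "card B = mrank M F"
        using extend_to_basis[of I F] assms by blast
      obtain T where T: "T \<subseteq> insert x F" "indep M T" "card T = mrank M (insert x F)"
        using mrank_attained by blast
      then have "card B < card T" using less B by simp
      then obtain y where y: "y \<in> T - B" "indep M (insert y B)" using augment B(3) T(2) by blast
      have "y \<notin> F"
      proof
        assume "y \<in> F"
        then have "card (insert y B) \<le> mrank M F" using y B by (intro mrank_ge) auto
        then show False using y B finite_indep by simp
      qed
      then have "y = x" "x \<notin> I" using y T B by auto
      then have "indep M (insert x I)" using y(2) B(1) indep_mono by blast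
      then have "card (insert x I) \<le> mrank M (insert x S)" using I by (intro mrank_ge) auto
      then show False using x I \<open>x \<notin> I\<close> finite_indep by (simp add: mspan_def)
    qed
  qed
  then show "x \<in> mspan M F" using x by (simp add: mspan_def)
qed

lemma mspan_increasing: "S \<subseteq> ground M \<Longrightarrow> S \<subseteq> mspan M S"
  by (auto simp: mspan_def insert_absorb)

lemma flat_if_card_le_1:
  assumes "simple M" "S \<subseteq> ground M" "card S \<le> 1"
  shows "S \<in> flats M"
proof -
  have fin: "finite S" using assms finite_ground finite_subset by blast
  have "x \<in> S" if x: "x \<in> mspan M S" for x
  proof (rule ccontr)
    assume "x \<notin> S"
    then have c: "card (insert x S) = Suc (card S)" using fin by simp
    have g: "insert x S \<subseteq> ground M" using x assms by (auto simp: mspan_def)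
    then have "indep M (insert x S)" using assms c unfolding simple_def by simp
    then have "Suc (card S) \<le> mrank M (insert x S)" using mrank_ge[of "insert x S" "insert x S"] c by simp
    moreover have "mrank M S \<le> card S" by (rule mrank_le) (use fin card_mono in auto)
    ultimately show False using x by (simp add: mspan_def)
  qed
  then show ?thesis using mspan_increasing[OF assms(2)] assms(2) by (auto simp: flats_def)
qed

end

section \<open>From an isomorphism of lattices to linear forms\<close>

lemma hyperplanes_subset: "H \<in> hyperplanes l \<Longrightarrow> H \<subseteq> carrier_vec l"
  by (auto simp: hyperplanes_def)

lemma hyperplanes_proper:
  assumes "H \<in> hyperplanes l"
  shows "H \<noteq> carrier_vec l"
proof
  assume H: "H = carrier_vec l"
  obtain a where a: "a \<in> carrier_vec l" "a \<noteq> 0\<^sub>v l" "H = {x \<in> carrier_vec l. a \<bullet> x = 0}"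
    using assms by (auto simp: hyperplanes_def)
  have "a $ i = 0" if "i < l" for i
  proof -
    have "unit_vec l i \<in> H" using H by simp
    then have "a \<bullet> unit_vec l i = 0" using a(3) by simp
    then show ?thesis using that a(1) by simp
  qed
  then have "a = 0\<^sub>v l" using a(1) by (intro eq_vecI) auto
  then show False using a(2) by simp
qed

text \<open>The isomorphism reverses inclusion, so it takes atoms to hyperplanes and joins to
  intersections. The last clause asks for the span to be a flat; for the lines of a net this comes
  from the base locus.\<close>

lemma realization_linear_forms:
  assumes M: "matroid M" "simple M" and real: "realizable_over_complex M"
  obtains f where "\<And>u. u \<in> ground M \<Longrightarrow> linear_form (f u)"
    and "\<And>u. u \<in> ground M \<Longrightarrow> \<exists>p. f u p \<noteq> 0"
    and "\<And>u v. u \<in> ground M \<Longrightarrow> v \<in> ground M \<Longrightarrow> u \<noteq> v \<Longrightarrow> \<exists>p. f u p = 0 \<and> f v p \<noteq> 0"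
    and "\<And>u v w. u \<in> ground M \<Longrightarrow> v \<in> ground M \<Longrightarrow> w \<in> ground M \<Longrightarrow> flat_join M u v \<in> flats M \<Longrightarrow>
      (\<forall>p. f u p = 0 \<longrightarrow> f v p = 0 \<longrightarrow> f w p = 0) \<longleftrightarrow> w \<in> flat_join M u v"
proof -
  interpret matroid M by (rule M(1))
  obtain l \<A> \<phi> where arr: "finite \<A>" "\<A> \<subseteq> hyperplanes l"
    and bij: "bij_betw \<phi> (flats M) (intersection_lattice l \<A>)"
    and anti: "\<forall>F\<in>flats M. \<forall>G\<in>flats M. F \<subseteq> G \<longleftrightarrow> \<phi> F \<supseteq> \<phi> G"
    using real unfolding realizable_over_complex_def central_arrangement_def
    by (elim exE conjE) (rule that)
  have order: "F \<subseteq> G \<longleftrightarrow> \<phi> G \<subseteq> \<phi> F" if "F \<in> flats M" "G \<in> flats M" for F G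
    using anti that by simp
  have img: "\<phi> ` flats M = intersection_lattice l \<A>" using bij by (simp add: bij_betw_def)
  have flat1: "{u} \<in> flats M" if "u \<in> ground M" for u
    using flat_if_card_le_1[OF M(2)] that by simp
  have flat0: "{} \<in> flats M" using flat_if_card_le_1[OF M(2)] by simp
  have lattice_sub: "X \<subseteq> carrier_vec l" if "X \<in> intersection_lattice l \<A>" for X
    using that by (auto simp: intersection_lattice_def)
  have "carrier_vec l \<in> intersection_lattice l \<A>"
    unfolding intersection_lattice_def by (auto intro!: exI[of _ "{}"])
  then obtain F where F: "F \<in> flats M" "\<phi> F = carrier_vec l" using img by (metis imageE)
  have "carrier_vec l \<subseteq> \<phi> {}" using order[OF flat0 F(1)] F(2) by simp
  then have phi0: "\<phi> {} = carrier_vec l" using lattice_sub img flat0 by blast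
  \<comment> \<open>Since \<open>\<phi> {u}\<close> is not the whole space, it lies in some
    hyperplane of the arrangement. That hyperplane is the image of a nonempty flat inside
    \<open>{u}\<close>, so it is \<open>\<phi> {u}\<close>.\<close>
  have atom: "\<phi> {u} \<in> hyperplanes l" if u: "u \<in> ground M" for u
  proof -
    have "\<phi> {u} \<in> intersection_lattice l \<A>" using flat1[OF u] img by blast
    then obtain \<B> where \<B>: "\<B> \<subseteq> \<A>" "\<phi> {u} = carrier_vec l \<inter> \<Inter>\<B>"
      unfolding intersection_lattice_def by blast
    have "\<B> \<noteq> {}"
    proof
      assume "\<B> = {}"
      then have "\<phi> {} \<subseteq> \<phi> {u}" using \<B> phi0 by simp
      then show False using order[OF flat1[OF u] flat0] by simp
    qed
    then obtain H where H: "H \<in> \<B>" by blast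
    then have Hh: "H \<in> hyperplanes l" using \<B> arr by blast
    have "H = carrier_vec l \<inter> \<Inter>{H}" using hyperplanes_subset[OF Hh] by auto
    then have "H \<in> intersection_lattice l \<A>" unfolding intersection_lattice_def using H \<B>(1) by blast
    then obtain G where G: "G \<in> flats M" "\<phi> G = H" using img by (metis imageE)
    have "\<phi> {u} \<subseteq> \<phi> G" using \<B>(2) H G(2) by blast
    then have "G \<subseteq> {u}" using order[OF G(1) flat1[OF u]] by simp
    moreover have "G \<noteq> {}" using G(2) phi0 hyperplanes_proper[OF Hh] by auto
    ultimately have "G = {u}" by blast
    then show ?thesis using G Hh by simp
  qed
  then obtain a where a: "\<And>u. u \<in> ground M \<Longrightarrow> a u \<in> carrier_vec l"
    "\<And>u. u \<in> ground M \<Longrightarrow> \<phi> {u} = {x \<in> carrier_vec l. a u \<bullet> x = 0}"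
    unfolding hyperplanes_def mem_Collect_eq by metis
  define f where "f u p = a u \<bullet> vec l p" for u and p :: "nat \<Rightarrow> complex"
  \<comment> \<open>Passes from functions on \<open>nat\<close> to vectors of dimension
    \<open>l\<close>; coordinates from \<open>l\<close> on are ignored.\<close>
  have vec_all: "(\<forall>p. P (vec l p)) \<longleftrightarrow> (\<forall>x\<in>carrier_vec l. P x)" for P :: "complex vec \<Rightarrow> bool"
  proof
    assume "\<forall>p. P (vec l p)"
    moreover have "x = vec l (\<lambda>i. x $ i)" if "x \<in> carrier_vec l" for x :: "complex vec"
      using that by auto
    ultimately show "\<forall>x\<in>carrier_vec l. P x" by metis
  qed auto
  show ?thesis
  proof
    show "linear_form (f u)" for u
      unfolding linear_form_def f_def scalar_prod_def
      by (simp add: sum.distrib sum_distrib_left algebra_simps)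
    show "\<exists>p. f u p \<noteq> 0" if "u \<in> ground M" for u
      using vec_all[of "\<lambda>x. a u \<bullet> x = 0"] hyperplanes_proper[OF atom[OF that]] a(2)[OF that]
      by (auto simp: f_def)
    show "\<exists>p. f u p = 0 \<and> f v p \<noteq> 0" if "u \<in> ground M" "v \<in> ground M" "u \<noteq> v" for u v
    proof (rule ccontr)
      assume "\<not> ?thesis"
      then have "\<phi> {u} \<subseteq> \<phi> {v}"
        using vec_all[of "\<lambda>x. a u \<bullet> x = 0 \<longrightarrow> a v \<bullet> x = 0"] a(2) that by (auto simp: f_def)
      then show False using order flat1 that by blast
    qed
    fix u v w assume g: "u \<in> ground M" "v \<in> ground M" "w \<in> ground M" and flat: "flat_join M u v \<in> flats M"
    have "\<phi> {u} \<in> intersection_lattice l \<A>" "\<phi> {v} \<in> intersection_lattice l \<A>"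
      using flat1 g img by blast+
    then obtain \<B> \<B>' where "\<B> \<subseteq> \<A>" "\<phi> {u} = carrier_vec l \<inter> \<Inter>\<B>" "\<B>' \<subseteq> \<A>" "\<phi> {v} = carrier_vec l \<inter> \<Inter>\<B>'"
      unfolding intersection_lattice_def by blast
    then have "\<B> \<union> \<B>' \<subseteq> \<A>" "\<phi> {u} \<inter> \<phi> {v} = carrier_vec l \<inter> \<Inter>(\<B> \<union> \<B>')" by auto
    then have "\<phi> {u} \<inter> \<phi> {v} \<in> intersection_lattice l \<A>" unfolding intersection_lattice_def by blast
    \<comment> \<open>The flat \<open>G\<close> mapped to the intersection is the join: it contains
      the span of \<open>u\<close> and \<open>v\<close> by monotonicity, and the reverse inclusion
      comes from comparing images.\<close>
    then obtain G where G: "G \<in> flats M" "\<phi> G = \<phi> {u} \<inter> \<phi> {v}" using img by (metis imageE)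
    have uvG: "{u} \<subseteq> G" "{v} \<subseteq> G" using order[OF flat1 G(1)] g G(2) by blast+
    then have "flat_join M u v \<subseteq> mspan M G" by (intro mspan_mono) auto
    then have sub: "flat_join M u v \<subseteq> G" using G(1) by (simp add: flats_def)
    have "{u} \<subseteq> flat_join M u v" "{v} \<subseteq> flat_join M u v" using mspan_increasing[of "{u, v}"] g by auto
    then have "\<phi> (flat_join M u v) \<subseteq> \<phi> G"
      unfolding G(2) using order[OF flat1 flat] g by blast
    then have "G = flat_join M u v" using order[OF G(1) flat] sub by blast
    moreover have "(\<forall>p. f u p = 0 \<longrightarrow> f v p = 0 \<longrightarrow> f w p = 0) \<longleftrightarrow> \<phi> G \<subseteq> \<phi> {w}"
      using vec_all[of "\<lambda>x. a u \<bullet> x = 0 \<longrightarrow> a v \<bullet> x = 0 \<longrightarrow> a w \<bullet> x = 0"] g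
      by (auto simp: G(2) f_def a(2))
    moreover have "\<phi> G \<subseteq> \<phi> {w} \<longleftrightarrow> {w} \<subseteq> G" using order[OF flat1 G(1)] g by blast
    ultimately show "(\<forall>p. f u p = 0 \<longrightarrow> f v p = 0 \<longrightarrow> f w p = 0) \<longleftrightarrow> w \<in> flat_join M u v" by simp
  qed
qed

section \<open>Triples of nets\<close>

lemma type3_third: "(a::3) \<noteq> b \<Longrightarrow> c \<noteq> a \<Longrightarrow> c \<noteq> b \<Longrightarrow> c = - a - b"
  using type3_cases[of a] type3_cases[of b] type3_cases[of c] by auto

lemma type3_exponent: "(a::3) + a + a = 0"
  using type3_cases[of a] by auto

context matroid
begin

text \<open>Multiplicities are positive and sum to 1 on each class within the flat, so every class
  has exactly one point there.\<close>

lemma net_line: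
  fixes N :: "('a, 3) multinet"
  assumes "simple M" "is_net M N" and uv: "u \<in> ground M" "v \<in> ground M" "net_fun M N u \<noteq> net_fun M N v"
  shows "flat_join M u v \<in> flats M" and "bij_betw (net_fun M N) (flat_join M u v) UNIV"
proof -
  have part: "labelled_partition (ground M) (cls N)"
    and base: "base_locus N \<subseteq> flats_of_rank M 2"
    and cross: "\<And>\<alpha> \<beta> u v. \<alpha> \<noteq> \<beta> \<Longrightarrow> u \<in> cls N \<alpha> \<Longrightarrow> v \<in> cls N \<beta> \<Longrightarrow> flat_join M u v \<in> base_locus N"
    and m: "\<And>u. u \<in> ground M \<Longrightarrow> multip N u > 0"
    and one: "\<And>X \<alpha>. X \<in> base_locus N \<Longrightarrow> (\<Sum>u\<in>cls N \<alpha> \<inter> X. multip N u) = 1"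
    using assms(2) unfolding is_net_def is_multinet_def by auto
  have cls: "u \<in> cls N \<alpha> \<longleftrightarrow> net_fun M N u = \<alpha>" if u: "u \<in> ground M" for u \<alpha>
  proof -
    obtain \<beta> where \<beta>: "u \<in> cls N \<beta>" using part u unfolding labelled_partition_def by blast
    have *: "u \<in> cls N \<alpha> \<longleftrightarrow> \<alpha> = \<beta>" for \<alpha> using part \<beta> by (auto simp: labelled_partition_def)
    then have "net_fun M N u = \<beta>" using u by (simp add: net_fun_def)
    then show ?thesis using * by auto
  qed
  let ?X = "flat_join M u v"
  have X: "?X \<in> base_locus N" using cross[OF uv(3)] cls uv by blast
  then show "?X \<in> flats M" using base by (auto simp: flats_of_rank_def)
  have Xg: "?X \<subseteq> ground M" by (auto simp: mspan_def)
  have ex1: "\<exists>!w. w \<in> ?X \<and> net_fun M N w = \<alpha>" for \<alpha>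
  proof -
    let ?C = "cls N \<alpha> \<inter> ?X"
    have fin: "finite ?C" using finite_subset[OF Xg finite_ground] by auto
    have "card ?C \<le> (\<Sum>u\<in>?C. multip N u)"
      using sum_mono[of ?C "\<lambda>_. 1" "multip N"] m Xg by (auto simp: Suc_le_eq)
    moreover have "?C \<noteq> {}" using one[OF X, of \<alpha>] by force
    ultimately have "card ?C = 1" using one[OF X, of \<alpha>] fin by (simp add: card_gt_0_iff le_antisym Suc_le_eq)
    then obtain w where "?C = {w}" by (auto simp: card_1_singleton_iff)
    moreover have "z \<in> ?C \<longleftrightarrow> z \<in> ?X \<and> net_fun M N z = \<alpha>" for z using cls Xg by auto
    ultimately have "z \<in> ?X \<and> net_fun M N z = \<alpha> \<longleftrightarrow> z = w" for z by auto
    then show ?thesis by metis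
  qed
  then show "bij_betw (net_fun M N) ?X UNIV"
    unfolding bij_betw_def inj_on_def by (metis UNIV_eq_I image_eqI)
qed

text \<open>Three points on a common line have all labels distinct or all equal, and in both cases
  the labels sum to 0. This covers lines outside the base locus of \<open>N\<close> too, such as
  lines obtained from another net.\<close>

lemma net_fun_third:
  fixes N :: "('a, 3) multinet"
  assumes "simple M" "is_net M N" and g: "u \<in> ground M" "v \<in> ground M" "w \<in> ground M"
    and d: "distinct [u, v, w]" and w: "w \<in> flat_join M u v"
  shows "net_fun M N w = - net_fun M N u - net_fun M N v"
proof -
  have uvX: "u \<in> flat_join M a b" "v \<in> flat_join M a b" if "{a, b} = {u, v}" for a b
    using mspan_increasing[of "{u, v}"] g that by auto
  have w_swap: "v \<in> flat_join M u w"
  proof -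
    have "\<not> indep M {u, v, w}" using join_iff[OF assms(1) d] w g by simp
    moreover have "{u, v, w} = {u, w, v}" by auto
    ultimately show ?thesis using join_iff[of u w v] assms(1) d g by auto
  qed
  show ?thesis
  proof (cases "net_fun M N u = net_fun M N v")
    case False
    note b = net_line(2)[OF assms(1,2) g(1,2) False]
    have "net_fun M N w \<noteq> net_fun M N z" if "z \<in> {u, v}" for z
      using inj_onD[OF bij_betw_imp_inj_on[OF b], of w z] w uvX[of u v] d that by auto
    then show ?thesis using False by (intro type3_third) auto
  next
    case True
    have "net_fun M N w = net_fun M N u"
    proof (rule ccontr)
      assume "net_fun M N w \<noteq> net_fun M N u"
      then have ne: "net_fun M N u \<noteq> net_fun M N w" by simp
      have "u \<in> flat_join M u w" using mspan_increasing[of "{u, w}"] g by auto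
      then have "u = v"
        using inj_onD[OF bij_betw_imp_inj_on[OF net_line(2)[OF assms(1,2) g(1,3) ne]] True] w_swap by blast
      then show False using d by simp
    qed
    then show ?thesis using True type3_exponent[of "net_fun M N u"] by (simp add: eq_diff_eq eq_neg_iff_add_eq_0 add.assoc)
  qed
qed

end

definition net_label :: "'a matroid \<Rightarrow> ('a, 3) multinet \<Rightarrow> ('a, 3) multinet \<Rightarrow> ('a, 3) multinet \<Rightarrow> 'a \<Rightarrow> 3 \<times> 3 \<times> 3"
  where "net_label M N N' N'' u = (net_fun M N u, net_fun M N' u, net_fun M N'' u)"

lemma (in matroid) net_label_line:
  assumes "simple M" and nets: "is_net M N" "is_net M N'" "is_net M N''"
    and uv: "u \<in> ground M" "v \<in> ground M" "net_label M N N' N'' u \<noteq> net_label M N N' N'' v"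
  shows "flat_join M u v \<in> flats M \<and> (\<exists>w\<in>ground M. flat_join M u v = {u, v, w} \<and>
    net_label M N N' N'' w = - net_label M N N' N'' u - net_label M N N' N'' v)"
proof -
  \<comment> \<open>Some net \<open>K\<close> among the three separates \<open>u\<close> and
    \<open>v\<close>; it shows that the line has three points, and \<open>net_fun_third\<close>
    gives the third label in every coordinate.\<close>
  obtain K where K: "is_net M K" "net_fun M K u \<noteq> net_fun M K v"
    using uv(3) nets by (auto simp: net_label_def)
  note line = net_line[OF assms(1) K(1) uv(1,2) K(2)]
  let ?X = "flat_join M u v"
  have X: "?X \<subseteq> ground M" "u \<in> ?X" "v \<in> ?X" using mspan_increasing[of "{u, v}"] uv by (auto simp: mspan_def)
  have "card ?X = 3" using bij_betw_same_card[OF line(2)] by simp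
  moreover have "u \<noteq> v" using K(2) by auto
  ultimately have "card (?X - {u, v}) = 1" using X by (simp add: card_Diff_subset)
  then obtain w where w: "?X - {u, v} = {w}" by (auto simp: card_1_singleton_iff)
  then have "?X = {u, v, w}" "w \<in> ground M" "distinct [u, v, w]" "w \<in> ?X"
    using X \<open>u \<noteq> v\<close> by auto
  then show ?thesis
    using line(1) nets[THEN net_fun_third[OF assms(1) _ uv(1,2)]] by (auto simp: net_label_def)
qed

section \<open>Coefficient triples paired with labels\<close>

definition dot3 :: "3 \<times> 3 \<times> 3 \<Rightarrow> 3 \<times> 3 \<times> 3 \<Rightarrow> 3" where
  "dot3 n x = fst n * fst x + fst (snd n) * fst (snd x) + snd (snd n) * snd (snd x)"

lemma dot3_diff_left: "dot3 (n - n') x = dot3 n x - dot3 n' x"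
  by (simp add: dot3_def algebra_simps)

lemma dot3_linear: "dot3 n (x + y) = dot3 n x + dot3 n y" "dot3 n (x - y) = dot3 n x - dot3 n y"
  "dot3 n (- x) = - dot3 n x" "dot3 n 0 = 0"
  by (simp_all add: dot3_def algebra_simps)

text \<open>Pigeonhole: the pairing with \<open>a\<close> and \<open>b\<close> maps 27 vectors to 9
  pairs, and the difference of two vectors with equal images is orthogonal to both.\<close>

lemma dot3_orthogonal: "\<exists>n. n \<noteq> 0 \<and> dot3 n a = 0 \<and> dot3 n b = 0"
proof -
  let ?h = "\<lambda>n. (dot3 n a, dot3 n b)"
  have "card (range ?h) \<le> card (UNIV :: (3 \<times> 3) set)" by (rule card_mono) auto
  also have "\<dots> < card (UNIV :: (3 \<times> 3 \<times> 3) set)" by (simp add: card_prod)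
  finally have "\<not> inj ?h" using card_image[of ?h UNIV] by auto
  then obtain n n' where "?h n = ?h n'" "n \<noteq> n'" unfolding inj_def by blast
  then show ?thesis by (intro exI[of _ "n - n'"]) (simp add: dot3_diff_left)
qed

theorem theorem1p4:
  fixes M :: "'a matroid"
    and N N' N'' :: "('a, 3) multinet"
  assumes "matroid M" and "simple M"
    and "is_net M N" and "is_net M N'" and "is_net M N''"
    and "lin_indep_quot (os_Z M) (os_B M) [net_fun M N, net_fun M N', net_fun M N'']"
  shows "\<not> realizable_over_complex M"
proof
  assume "realizable_over_complex M"
  from realization_linear_forms[OF assms(1,2) this] obtain f where
    lin: "\<And>u. u \<in> ground M \<Longrightarrow> linear_form (f u)" and
    nonzero: "\<And>u. u \<in> ground M \<Longrightarrow> \<exists>p. f u p \<noteq> 0" and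
    indep2: "\<And>u v. u \<in> ground M \<Longrightarrow> v \<in> ground M \<Longrightarrow> u \<noteq> v \<Longrightarrow> \<exists>p. f u p = 0 \<and> f v p \<noteq> 0" and
    join: "\<And>u v w. u \<in> ground M \<Longrightarrow> v \<in> ground M \<Longrightarrow> w \<in> ground M \<Longrightarrow> flat_join M u v \<in> flats M \<Longrightarrow>
      (\<forall>p. f u p = 0 \<longrightarrow> f v p = 0 \<longrightarrow> f w p = 0) \<longleftrightarrow> w \<in> flat_join M u v"
    by blast
  interpret matroid M by (rule assms(1))
  have "\<exists>p\<in>UNIV. \<forall>u\<in>ground M. f u p \<noteq> 0"
    by (rule generic_point[OF finite_ground]) (use lin nonzero in auto)
  then obtain x0 where x0: "\<And>u. u \<in> ground M \<Longrightarrow> f u x0 \<noteq> 0" by blast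
  have "labelled_partition (ground M) (cls N)"
    using assms(3) unfolding is_net_def is_multinet_def by blast
  then have "cls N 0 \<noteq> {}" "cls N 0 \<subseteq> ground M" by (auto simp: labelled_partition_def)
  then obtain u0 where u0: "u0 \<in> ground M" by blast
  define \<Lambda> where "\<Lambda> = net_label M N N' N''"
  \<comment> \<open>The translation makes 0 a label, and dividing by the value at \<open>x0\<close>
    normalises the forms. The relation for third points survives the translation because
    \<open>3 * \<Lambda> u0\<close> is zero.\<close>
  define L where "L u = \<Lambda> u - \<Lambda> u0" for u
  define g where "g u p = inverse (f u x0) * f u p" for u p
  have exp: "(x :: 3 \<times> 3 \<times> 3) + x + x = 0" for x
    by (cases x) (simp only: plus_prod_def fst_conv snd_conv type3_exponent zero_prod_def)
  have g0: "g u p = 0 \<longleftrightarrow> f u p = 0" if "u \<in> ground M" for u p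
    using x0[OF that] by (simp add: g_def)
  interpret labelled_arrangement "ground M" g L x0
  proof
    show "linear_form (g u)" if "u \<in> ground M" for u
      unfolding g_def by (rule linear_form_scale[OF lin[OF that]])
    show "g u x0 = 1" if "u \<in> ground M" for u using x0[OF that] by (simp add: g_def)
    show "\<exists>u\<in>ground M. L u = 0" using u0 by (auto simp: L_def)
    fix u v assume uv: "u \<in> ground M" "v \<in> ground M"
    show "\<exists>p. g u p = 0 \<and> g v p \<noteq> 0" if "u \<noteq> v" using indep2[OF uv that] g0 uv by simp
    assume "L u \<noteq> L v"
    then have "net_label M N N' N'' u \<noteq> net_label M N N' N'' v" by (auto simp: L_def \<Lambda>_def)
    from net_label_line[OF assms(2-5) uv this] obtain w where
      flat: "flat_join M u v \<in> flats M" and w: "w \<in> ground M" "flat_join M u v = {u, v, w}"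
      and \<Lambda>w: "\<Lambda> w = - \<Lambda> u - \<Lambda> v"
      unfolding \<Lambda>_def by blast
    have "L w = - \<Lambda> u - \<Lambda> v - \<Lambda> u0 + (\<Lambda> u0 + \<Lambda> u0 + \<Lambda> u0)" by (simp only: L_def \<Lambda>w exp) simp
    then have "L w = - L u - L v" by (simp add: L_def)
    moreover have "\<forall>z\<in>ground M. (\<forall>p. g u p = 0 \<longrightarrow> g v p = 0 \<longrightarrow> g z p = 0) \<longleftrightarrow> z \<in> {u, v, w}"
      using join[OF uv _ flat] w(2) g0 uv by simp
    ultimately show "\<exists>w\<in>ground M. L w = - L u - L v \<and>
        (\<forall>z\<in>ground M. (\<forall>p. g u p = 0 \<longrightarrow> g v p = 0 \<longrightarrow> g z p = 0) \<longleftrightarrow> z \<in> {u, v, w})"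
      using w(1) by blast
  qed (use finite_ground exp in auto)
  \<comment> \<open>If all labels lay in the span of \<open>a\<close> and \<open>b\<close>, a
    nonzero \<open>n\<close> orthogonal to both would be a coefficient triple for which the
    combination of the three net functions is constant on the ground set, against independence
    modulo \<open>os_B M\<close>.\<close>
  have outside: "\<exists>c\<in>L ` ground M. c \<notin> {0, a, - a, b, - b, a + b, - a - b, a - b, b - a}" for a b
  proof (rule ccontr)
    assume "\<not> ?thesis"
    then have sub: "L u \<in> {0, a, - a, b, - b, a + b, - a - b, a - b, b - a}" if "u \<in> ground M" for u
      using that by blast
    obtain n where n: "n \<noteq> 0" "dot3 n a = 0" "dot3 n b = 0" using dot3_orthogonal by blast
    have "dot3 n (L u) = 0" if "u \<in> ground M" for u
      using sub[OF that] by (elim insertE emptyE) (simp_all add: dot3_linear n)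
    then have const: "dot3 n (\<Lambda> u) = dot3 n (\<Lambda> u0)" if "u \<in> ground M" for u
      using that by (simp add: L_def dot3_linear)
    obtain n1 n2 n3 where n_eq: "n = (n1, n2, n3)" by (cases n)
    define c where "c i = [n1, n2, n3] ! i" for i
    have "(\<Sum>i<length [net_fun M N, net_fun M N', net_fun M N''].
        c i * ([net_fun M N, net_fun M N', net_fun M N''] ! i) u) =
      (if u \<in> ground M then dot3 n (\<Lambda> u0) else 0)" for u
    proof (cases "u \<in> ground M")
      case True
      then show ?thesis
        unfolding const[OF True, symmetric]
        by (simp add: c_def n_eq dot3_def \<Lambda>_def net_label_def lessThan_Suc algebra_simps)
    next
      case False
      then show ?thesis by (simp add: net_fun_def lessThan_Suc)
    qed
    then have "(\<lambda>u. \<Sum>i<length [net_fun M N, net_fun M N', net_fun M N''].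
        c i * ([net_fun M N, net_fun M N', net_fun M N''] ! i) u) \<in> os_B M"
      unfolding os_B_def by auto
    then have "\<forall>i<3. c i = 0"
      using assms(6) unfolding lin_indep_quot_def by (simp add: numeral_3_eq_3)
    then have "c 0 = 0" "c 1 = 0" "c 2 = 0" by simp_all
    then show False using n(1) by (simp add: c_def n_eq zero_prod_def)
  qed
  \<comment> \<open>With zero arguments the excluded set shrinks to the origin and then to a line
    through it, so \<open>outside\<close> yields in turn a nonzero label, one off its line and one
    off the plane of both.\<close>
  obtain a where a: "a \<in> L ` ground M" "a \<noteq> 0" using outside[of 0 0] by blast
  obtain b where b: "b \<in> L ` ground M" "b \<notin> {0, a, - a}" using outside[of a 0] by blast
  obtain c where "c \<in> L ` ground M" "c \<notin> {0, a, - a, b, - b, a + b, - a - b, a - b, b - a}"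
    using outside[of a b] by (rule bexE)
  then show False by (rule no_spatial_configuration[OF frameI[OF a(1) b(1) a(2) b(2)]])
qed

end
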